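(* Let $\mathcal{U}$ be a Hilbert space and let $f$ be an $L(\mathcal{U})$-valued function holomorphic on $\Pi^N$. Then $f\in\mathcal{B}_N(\mathcal{U})$ if and only if there exist holomorphic PSD kernels $\Phi_k(z,\zeta)$, $k=1,\ldots,N$, on $\Pi^N\times\Pi^N$ such that $$f(z)=\sum_{k=1}^N z_k\Phi_k(z,\zeta),\quad (z,\zeta)\in\Pi^N\times\Pi^N.$$ In this case the kernels $\Phi_k(z,\zeta)$, $k=1,\ldots,N$, can be uniquely extended to holomorphic PSD kernels on $\Omega_N\times\Omega_N$ (denoted by the same letters) which are homogeneous of degree zero, i.e., for any $\lambda\in\mathbb{C}\setminus\{0\}$ $$\Phi_k(\lambda z,\lambda\zeta)=\Phi_k(z,\zeta),\quad (z,\zeta)\in\Omega_N\times\Omega_N,$$ and the identity $f(z)=\sum_{k=1}^N z_k\Phi_k(z,\zeta)$ extends to all $(z,\zeta)\in\Omega_N\times\Omega_N$.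
   Context: All Hilbert spaces are complex; $L(\mathcal{U})$ denotes the bounded linear operators on $\mathcal{U}$. $\Pi=\{z\in\mathbb{C}:\mathrm{Re}\,z>0\}$, $\mathbb{T}$ is the unit circle, $\Omega_N=\bigcup_{\lambda\in\mathbb{T}}(\lambda\Pi)^N\subset\mathbb{C}^N$. The class $\mathcal{B}_N(\mathcal{U})$ consists of the $L(\mathcal{U})$-valued functions $f$ holomorphic on $\Omega_N$ and representable as $f(z)=a(z)-b(z)d(z)^{-1}c(z)$, $z\in\Omega_N$, where, for some Hilbert space $\mathcal{H}$, $A(z)=z_1A_1+\cdots+z_NA_N=\begin{bmatrix} a(z)&b(z)\\ c(z)&d(z)\end{bmatrix}\in L(\mathcal{U}\oplus\mathcal{H})$ with bounded positive semidefinite operators $A_k=A_k^*$ on $\mathcal{U}\oplus\mathcal{H}$ (and $d(z)$ boundedly invertible for $z\in\Omega_N$). A function holomorphic on $\Pi^N$ having such a representation there extends uniquely by homogeneity of degree one to a function on $\Omega_N$ having such a representation; for a function $f$ defined originally on $\Pi^N$, $f\in\mathcal{B}_N(\mathcal{U})$ means that this extension belongs to $\mathcal{B}_N(\mathcal{U})$, and $f$ on $\Omega_N$ denotes the extension. Holomorphic PSD kernel on $\Omega\times\Omega$ ($\Omega\subset\mathbb{C}^N$ a domain): an $L(\mathcal{U})$-valued function $\Phi(z,\zeta)$ on $\Omega\times\Omega$, holomorphic in $z$ and anti-holomorphic in $\zeta$, with $\Phi(z,\zeta)=\Phi(\zeta,z)^*$ and $\sum_{\mu,\nu=1}^m\langle\Phi(z^{(\mu)},z^{(\nu)})u^{(\mu)},u^{(\nu)}\rangle\ge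 0$ for all $m\in\mathbb{N}$, $z^{(\mu)}\in\Omega$, $u^{(\mu)}\in\mathcal{U}$. *)

theory Defs
  imports "HOL-Analysis.Analysis"
begin

section \<open>Complex Hilbert spaces\<close>

class scaleC =
  fixes scaleC :: "complex \<Rightarrow> 'a \<Rightarrow> 'a"  (infixr "*\<^sub>C" 75)

class complex_vector = real_vector + scaleC +
  assumes scaleC_add_right: "c *\<^sub>C (x + y) = c *\<^sub>C x + c *\<^sub>C y"
    and scaleC_add_left: "(c + d) *\<^sub>C x = c *\<^sub>C x + d *\<^sub>C x"
    and scaleC_scaleC: "c *\<^sub>C (d *\<^sub>C x) = (c * d) *\<^sub>C x"
    and scaleC_one: "1 *\<^sub>C x = x"
    and scaleR_scaleC: "r *\<^sub>R x = complex_of_real r *\<^sub>C x"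

text \<open>
  The scalar product is linear in its first argument. The fact \<open>inner_Re_cinner\<close> ties it to the
  library's norm and topology: the norm of \<open>x\<close> is the square root of \<open>cinner x x\<close>.
\<close>

class complex_hilbert = complex_vector + real_inner + complete_space +
  fixes cinner :: "'a \<Rightarrow> 'a \<Rightarrow> complex"
  assumes cinner_commute: "cinner x y = cnj (cinner y x)"
    and cinner_add_left: "cinner (x + y) z = cinner x z + cinner y z"
    and cinner_scaleC_left: "cinner (c *\<^sub>C x) y = c * cinner x y"
    and inner_Re_cinner: "inner x y = Re (cinner x y)"
begin

lemma cinner_self: "cinner x x = complex_of_real ((norm x)\<^sup>2)"
proof -
  have "Im (cinner x x) = 0"
    using arg_cong[OF cinner_commute[of x x], of Im] by simp
  moreover have "Re (cinner x x) = (norm x)\<^sup>2"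
    by (metis inner_Re_cinner power2_norm_eq_inner)
  ultimately show ?thesis
    by (simp add: complex_eq_iff)
qed

lemma norm_scaleC: "norm (c *\<^sub>C x) = cmod c * norm x"
proof -
  have "complex_of_real ((norm (c *\<^sub>C x))\<^sup>2) = cinner (c *\<^sub>C x) (c *\<^sub>C x)"
    by (simp only: cinner_self)
  also have "\<dots> = c * cnj c * cinner x x"
    using cinner_commute[of x "c *\<^sub>C x"] cinner_commute[of x x]
    by (simp add: cinner_scaleC_left)
  also have "\<dots> = complex_of_real ((cmod c * norm x)\<^sup>2)"
    by (simp only: cinner_self power_mult_distrib of_real_mult complex_norm_square)
  finally have "(norm (c *\<^sub>C x))\<^sup>2 = (cmod c * norm x)\<^sup>2"
    by (simp only: of_real_eq_iff)
  then show ?thesis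
    by (simp add: power2_eq_iff_nonneg)
qed

end

lemma bounded_linear_scaleC: "bounded_linear (\<lambda>x::'a::complex_hilbert. c *\<^sub>C x)"
proof (rule bounded_linear_intro)
  show "c *\<^sub>C (x + y) = c *\<^sub>C x + c *\<^sub>C y" for x y :: 'a
    by (rule scaleC_add_right)
  show "c *\<^sub>C (r *\<^sub>R x) = r *\<^sub>R (c *\<^sub>C x)" for r and x :: 'a
    by (simp add: scaleR_scaleC scaleC_scaleC mult.commute)
  show "norm (c *\<^sub>C x) \<le> norm x * cmod c" for x :: 'a
    by (simp add: norm_scaleC mult.commute)
qed

text \<open>The orthogonal sum of two Hilbert spaces; the library supplies the norm of the product.\<close>

instantiation prod :: (complex_hilbert, complex_hilbert) complex_hilbert
begin

definition scaleC_prod :: "complex \<Rightarrow> 'a \<times> 'b \<Rightarrow> 'a \<times> 'b" where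
  "scaleC_prod c p = (c *\<^sub>C fst p, c *\<^sub>C snd p)"

definition cinner_prod :: "'a \<times> 'b \<Rightarrow> 'a \<times> 'b \<Rightarrow> complex" where
  "cinner_prod p q = cinner (fst p) (fst q) + cinner (snd p) (snd q)"

instance
proof
  fix c d :: complex and r :: real and x y z :: "'a \<times> 'b"
  show "c *\<^sub>C (x + y) = c *\<^sub>C x + c *\<^sub>C y"
    by (simp add: scaleC_prod_def scaleC_add_right)
  show "(c + d) *\<^sub>C x = c *\<^sub>C x + d *\<^sub>C x"
    by (simp add: scaleC_prod_def scaleC_add_left)
  show "c *\<^sub>C (d *\<^sub>C x) = (c * d) *\<^sub>C x"
    by (simp add: scaleC_prod_def scaleC_scaleC)
  show "1 *\<^sub>C x = x"
    by (simp add: scaleC_prod_def scaleC_one)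
  show "r *\<^sub>R x = complex_of_real r *\<^sub>C x"
    by (simp add: scaleC_prod_def scaleR_prod_def scaleR_scaleC)
  show "cinner x y = cnj (cinner y x)"
    unfolding cinner_prod_def complex_cnj_add
    by (intro arg_cong2[where f = "(+)"] cinner_commute)
  show "cinner (x + y) z = cinner x z + cinner y z"
    by (simp add: cinner_prod_def cinner_add_left)
  show "cinner (c *\<^sub>C x) y = c * cinner x y"
    by (simp add: cinner_prod_def scaleC_prod_def cinner_scaleC_left distrib_left)
  show "inner x y = Re (cinner x y)"
    by (simp add: cinner_prod_def inner_prod_def inner_Re_cinner)
qed

end


section \<open>The Hilbert space of square-summable families\<close>

typedef 'i ell2 = "{f :: 'i \<Rightarrow> complex. (\<lambda>i. (cmod (f i))\<^sup>2) summable_on UNIV}"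
  by (rule exI[of _ "\<lambda>_. 0"]) simp

setup_lifting type_definition_ell2

lemma ell2_add:
  fixes f g :: "'i \<Rightarrow> complex"
  assumes "(\<lambda>i. (cmod (f i))\<^sup>2) summable_on UNIV" "(\<lambda>i. (cmod (g i))\<^sup>2) summable_on UNIV"
  shows "(\<lambda>i. (cmod (f i + g i))\<^sup>2) summable_on UNIV"
proof (rule summable_on_comparison_test)
  show "(\<lambda>i. 2 * (cmod (f i))\<^sup>2 + 2 * (cmod (g i))\<^sup>2) summable_on UNIV"
    using assms by (intro summable_on_add summable_on_cmult_right)
  fix i
  have "(cmod (f i + g i))\<^sup>2 \<le> (cmod (f i) + cmod (g i))\<^sup>2"
    by (intro power_mono norm_triangle_ineq) simp
  also have "\<dots> \<le> 2 * (cmod (f i))\<^sup>2 + 2 * (cmod (g i))\<^sup>2"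
    using zero_le_power2[of "cmod (f i) - cmod (g i)"] by (simp add: power2_eq_square algebra_simps)
  finally show "(cmod (f i + g i))\<^sup>2 \<le> 2 * (cmod (f i))\<^sup>2 + 2 * (cmod (g i))\<^sup>2" .
qed auto

lemma ell2_scale:
  fixes f :: "'i \<Rightarrow> complex"
  assumes "(\<lambda>i. (cmod (f i))\<^sup>2) summable_on UNIV"
  shows "(\<lambda>i. (cmod (c * f i))\<^sup>2) summable_on UNIV"
  using summable_on_cmult_right[OF assms, of "(cmod c)\<^sup>2"]
  by (simp add: norm_mult power_mult_distrib)

lemma ell2_mult:
  fixes f g :: "'i \<Rightarrow> complex"
  assumes "(\<lambda>i. (cmod (f i))\<^sup>2) summable_on UNIV" "(\<lambda>i. (cmod (g i))\<^sup>2) summable_on UNIV"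
  shows "(\<lambda>i. f i * cnj (g i)) summable_on UNIV"
proof (rule abs_summable_summable, rule summable_on_comparison_test)
  show "(\<lambda>i. (cmod (f i))\<^sup>2 + (cmod (g i))\<^sup>2) summable_on UNIV"
    using assms by (intro summable_on_add)
  fix i
  show "cmod (f i * cnj (g i)) \<le> (cmod (f i))\<^sup>2 + (cmod (g i))\<^sup>2"
    using sum_squares_bound[of "cmod (f i)" "cmod (g i)"]
      mult_nonneg_nonneg[OF norm_ge_zero norm_ge_zero, of "f i" "g i"]
    by (simp only: norm_mult complex_mod_cnj)
qed auto

instantiation ell2 :: (type) complex_vector
begin

lift_definition zero_ell2 :: "'a ell2" is "\<lambda>_. 0"
  by simp

lift_definition plus_ell2 :: "'a ell2 \<Rightarrow> 'a ell2 \<Rightarrow> 'a ell2" is "\<lambda>f g i. f i + g i"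
  by (rule ell2_add)

lift_definition uminus_ell2 :: "'a ell2 \<Rightarrow> 'a ell2" is "\<lambda>f i. - f i"
  by simp

lift_definition minus_ell2 :: "'a ell2 \<Rightarrow> 'a ell2 \<Rightarrow> 'a ell2" is "\<lambda>f g i. f i - g i"
  using ell2_add[where g = "\<lambda>i. - g i" for g] by simp

lift_definition scaleC_ell2 :: "complex \<Rightarrow> 'a ell2 \<Rightarrow> 'a ell2" is "\<lambda>c f i. c * f i"
  by (rule ell2_scale)

lift_definition scaleR_ell2 :: "real \<Rightarrow> 'a ell2 \<Rightarrow> 'a ell2" is "\<lambda>r f i. complex_of_real r * f i"
  by (rule ell2_scale)

instance
  by standard (transfer; simp add: algebra_simps fun_eq_iff)+

end

instantiation ell2 :: (type) real_inner
begin

definition inner_ell2 :: "'a ell2 \<Rightarrow> 'a ell2 \<Rightarrow> real" where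
  "inner_ell2 f g = Re (\<Sum>\<^sub>\<infinity>i. Rep_ell2 f i * cnj (Rep_ell2 g i))"

definition norm_ell2 :: "'a ell2 \<Rightarrow> real" where
  "norm_ell2 f = sqrt (inner f f)"

definition dist_ell2 :: "'a ell2 \<Rightarrow> 'a ell2 \<Rightarrow> real" where
  "dist_ell2 f g = norm (f - g)"

definition sgn_ell2 :: "'a ell2 \<Rightarrow> 'a ell2" where
  "sgn_ell2 f = f /\<^sub>R norm f"

definition uniformity_ell2 :: "('a ell2 \<times> 'a ell2) filter" where
  "uniformity_ell2 = (INF e\<in>{0 <..}. principal {(x, y). dist x y < e})"

definition open_ell2 :: "'a ell2 set \<Rightarrow> bool" where
  "open_ell2 U \<longleftrightarrow> (\<forall>x\<in>U. eventually (\<lambda>(x', y). x' = x \<longrightarrow> y \<in> U) uniformity)"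

lemma Rep_ell2_summable: "(\<lambda>i. (cmod (Rep_ell2 f i))\<^sup>2) summable_on UNIV"
  using Rep_ell2[of f] by simp

lemma inner_ell2_self: "inner f f = (\<Sum>\<^sub>\<infinity>i. (cmod (Rep_ell2 f i))\<^sup>2)"
proof -
  have "inner f f = (\<Sum>\<^sub>\<infinity>i. Re (Rep_ell2 f i * cnj (Rep_ell2 f i)))"
    unfolding inner_ell2_def
    by (rule infsum_Re[symmetric]) (intro ell2_mult Rep_ell2_summable)
  then show ?thesis
    by (simp only: complex_norm_square[symmetric] Re_complex_of_real)
qed

instance
proof
  fix x y z :: "'a ell2" and r :: real
  show "dist x y = norm (x - y)" by (rule dist_ell2_def)
  show "sgn x = x /\<^sub>R norm x" by (rule sgn_ell2_def)
  show "uniformity = (INF e\<in>{0 <..}. principal {(x :: 'a ell2, y). dist x y < e})"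
    by (rule uniformity_ell2_def)
  show "open U \<longleftrightarrow> (\<forall>x\<in>U. \<forall>\<^sub>F (x', y) in uniformity. x' = x \<longrightarrow> y \<in> U)" for U :: "'a ell2 set"
    by (rule open_ell2_def)
  show "inner x y = inner y x"
  proof -
    have "(\<Sum>\<^sub>\<infinity>i. Rep_ell2 x i * cnj (Rep_ell2 y i)) = cnj (\<Sum>\<^sub>\<infinity>i. Rep_ell2 y i * cnj (Rep_ell2 x i))"
      by (simp add: mult.commute flip: infsum_cnj)
    then show ?thesis
      by (simp add: inner_ell2_def)
  qed
  show "inner (x + y) z = inner x z + inner y z"
    by (simp add: inner_ell2_def plus_ell2.rep_eq distrib_right infsum_add ell2_mult Rep_ell2_summable)
  show "inner (r *\<^sub>R x) y = r * inner x y"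
    by (simp add: inner_ell2_def scaleR_ell2.rep_eq mult.assoc infsum_cmult_right')
  show "0 \<le> inner x x"
    by (simp add: inner_ell2_self infsum_nonneg)
  show "inner x x = 0 \<longleftrightarrow> x = 0"
  proof
    assume "inner x x = 0"
    then have "(cmod (Rep_ell2 x i))\<^sup>2 = 0" for i
      using nonneg_infsum_le_0D[OF _ Rep_ell2_summable[of x], of i] by (simp add: inner_ell2_self)
    then show "x = 0"
      by (simp add: Rep_ell2_inject[symmetric] zero_ell2.rep_eq fun_eq_iff)
  qed (simp add: inner_ell2_self zero_ell2.rep_eq)
  show "norm x = sqrt (inner x x)" by (rule norm_ell2_def)
qed

end

lemma sum_le_norm_ell2:
  assumes "finite F"
  shows "(\<Sum>i\<in>F. (cmod (Rep_ell2 f i))\<^sup>2) \<le> (norm f)\<^sup>2"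
proof -
  have "(norm f)\<^sup>2 = (\<Sum>\<^sub>\<infinity>i. (cmod (Rep_ell2 f i))\<^sup>2)"
    by (simp only: power2_norm_eq_inner[of f] inner_ell2_self)
  then show ?thesis
    using finite_sum_le_infsum[OF Rep_ell2_summable assms, of f] by simp
qed

lemma norm_Rep_ell2_le: "cmod (Rep_ell2 f i) \<le> norm f"
  by (rule power2_le_imp_le) (use sum_le_norm_ell2[of "{i}" f] in auto)

instance ell2 :: (type) complete_space
proof
  fix X :: "nat \<Rightarrow> 'a ell2"
  assume X: "Cauchy X"
  have "Cauchy (\<lambda>n. Rep_ell2 (X n) i)" for i
  proof (rule metric_CauchyI)
    fix e :: real assume "e > 0"
    then obtain M where M: "\<forall>m\<ge>M. \<forall>n\<ge>M. dist (X m) (X n) < e"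
      using X metric_CauchyD by blast
    have "dist (Rep_ell2 (X m) i) (Rep_ell2 (X n) i) \<le> dist (X m) (X n)" for m n
      using norm_Rep_ell2_le[of "X m - X n" i] by (simp add: dist_norm minus_ell2.rep_eq)
    with M show "\<exists>M. \<forall>m\<ge>M. \<forall>n\<ge>M. dist (Rep_ell2 (X m) i) (Rep_ell2 (X n) i) < e"
      using order_le_less_trans by blast
  qed
  then have "\<forall>i. \<exists>l. (\<lambda>n. Rep_ell2 (X n) i) \<longlonglongrightarrow> l"
    using Cauchy_convergent convergent_def by blast
  then obtain g where g: "\<And>i. (\<lambda>n. Rep_ell2 (X n) i) \<longlonglongrightarrow> g i"
    by metis
  have bound: "(\<Sum>i\<in>F. (cmod (Rep_ell2 (X m) i - g i))\<^sup>2) \<le> e\<^sup>2"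
    if e: "\<forall>n\<ge>M. dist (X m) (X n) < e" and F: "finite F" for M m e F
  proof (rule LIMSEQ_le_const2)
    show "(\<lambda>n. \<Sum>i\<in>F. (cmod (Rep_ell2 (X m) i - Rep_ell2 (X n) i))\<^sup>2)
        \<longlonglongrightarrow> (\<Sum>i\<in>F. (cmod (Rep_ell2 (X m) i - g i))\<^sup>2)"
      by (intro tendsto_intros g)
    have "(\<Sum>i\<in>F. (cmod (Rep_ell2 (X m) i - Rep_ell2 (X n) i))\<^sup>2) \<le> e\<^sup>2" if "n \<ge> M" for n
    proof -
      have "(\<Sum>i\<in>F. (cmod (Rep_ell2 (X m) i - Rep_ell2 (X n) i))\<^sup>2) \<le> (norm (X m - X n))\<^sup>2"
        using sum_le_norm_ell2[OF F, of "X m - X n"] by (simp add: minus_ell2.rep_eq)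
      also have "\<dots> \<le> e\<^sup>2"
        using e that by (intro power_mono) (auto simp: dist_norm less_imp_le)
      finally show ?thesis .
    qed
    then show "\<exists>N. \<forall>n\<ge>N. (\<Sum>i\<in>F. (cmod (Rep_ell2 (X m) i - Rep_ell2 (X n) i))\<^sup>2) \<le> e\<^sup>2"
      by blast
  qed
  have diff_summable: "(\<lambda>i. (cmod (Rep_ell2 (X m) i - g i))\<^sup>2) summable_on UNIV"
    if "\<forall>n\<ge>M. dist (X m) (X n) < e" for M m e
    using bound[OF that]
    by (intro nonneg_bdd_above_summable_on) (auto simp: bdd_above_def)
  obtain M1 where "\<forall>m\<ge>M1. \<forall>n\<ge>M1. dist (X m) (X n) < 1"
    using X metric_CauchyD[of X 1] by auto
  then have d1: "(\<lambda>i. (cmod (Rep_ell2 (X M1) i - g i))\<^sup>2) summable_on UNIV"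
    using diff_summable[of M1 M1 1] by blast
  have "(\<lambda>i. (cmod (- (Rep_ell2 (X M1) i - g i)))\<^sup>2) summable_on UNIV"
    using d1 by (simp only: norm_minus_cancel)
  from ell2_add[OF Rep_ell2_summable[of "X M1"] this]
  have g_ell2: "(\<lambda>i. (cmod (g i))\<^sup>2) summable_on UNIV"
    by simp
  define L where "L = Abs_ell2 g"
  have L: "Rep_ell2 L = g"
    using g_ell2 by (simp add: L_def Abs_ell2_inverse)
  have "X \<longlonglongrightarrow> L"
  proof (rule metric_LIMSEQ_I)
    fix r :: real assume "r > 0"
    then obtain M where M: "\<forall>m\<ge>M. \<forall>n\<ge>M. dist (X m) (X n) < r / 2"
      using X metric_CauchyD[of X "r / 2"] by auto
    have "dist (X m) L < r" if "m \<ge> M" for m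
    proof -
      have m: "\<forall>n\<ge>M. dist (X m) (X n) < r / 2"
        using M that by blast
      have "(norm (X m - L))\<^sup>2 = (\<Sum>\<^sub>\<infinity>i. (cmod (Rep_ell2 (X m) i - g i))\<^sup>2)"
        by (simp only: power2_norm_eq_inner[of "X m - L"] inner_ell2_self minus_ell2.rep_eq L)
      also have "\<dots> \<le> (r / 2)\<^sup>2"
        using bound[OF m] by (intro infsum_le_finite_sums diff_summable[OF m]) auto
      finally have "norm (X m - L) \<le> r / 2"
        by (rule power2_le_imp_le) (use \<open>r > 0\<close> in simp)
      then show ?thesis
        using \<open>r > 0\<close> by (simp add: dist_norm)
    qed
    then show "\<exists>no. \<forall>n\<ge>no. dist (X n) L < r"
      by blast
  qed
  then show "convergent X"
    by (auto simp: convergent_def)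
qed

instantiation ell2 :: (type) complex_hilbert
begin

definition cinner_ell2 :: "'a ell2 \<Rightarrow> 'a ell2 \<Rightarrow> complex" where
  "cinner_ell2 f g = (\<Sum>\<^sub>\<infinity>i. Rep_ell2 f i * cnj (Rep_ell2 g i))"

instance
proof
  fix x y z :: "'a ell2" and c :: complex
  show "cinner x y = cnj (cinner y x)"
    by (simp add: cinner_ell2_def mult.commute flip: infsum_cnj)
  show "cinner (x + y) z = cinner x z + cinner y z"
    by (simp add: cinner_ell2_def plus_ell2.rep_eq distrib_right infsum_add ell2_mult Rep_ell2_summable)
  show "cinner (c *\<^sub>C x) y = c * cinner x y"
    by (simp add: cinner_ell2_def scaleC_ell2.rep_eq mult.assoc infsum_cmult_right')
  show "inner x y = Re (cinner x y)"
    by (simp add: cinner_ell2_def inner_ell2_def)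
qed

end


section \<open>Operators\<close>

text \<open>
  The library type \<open>'a \<Rightarrow>\<^sub>L 'b\<close> consists of the bounded real-linear maps; \<open>clinear_blinfun\<close> singles
  out the complex-linear ones, i.e. the operators in \<open>L('a, 'b)\<close>.
\<close>

definition clinear_blinfun :: "('a::complex_hilbert \<Rightarrow>\<^sub>L 'b::complex_hilbert) \<Rightarrow> bool" where
  "clinear_blinfun T \<longleftrightarrow> (\<forall>c x. blinfun_apply T (c *\<^sub>C x) = c *\<^sub>C blinfun_apply T x)"

instantiation blinfun :: (real_normed_vector, complex_hilbert) complex_vector
begin

lift_definition scaleC_blinfun :: "complex \<Rightarrow> 'a \<Rightarrow>\<^sub>L 'b \<Rightarrow> 'a \<Rightarrow>\<^sub>L 'b" is "\<lambda>c T x. c *\<^sub>C T x"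
  by (rule bounded_linear_compose[OF bounded_linear_scaleC])

instance
proof
  fix c d :: complex and r :: real and x y :: "'a \<Rightarrow>\<^sub>L 'b"
  show "c *\<^sub>C (x + y) = c *\<^sub>C x + c *\<^sub>C y"
    by transfer (simp add: scaleC_add_right)
  show "(c + d) *\<^sub>C x = c *\<^sub>C x + d *\<^sub>C x"
    by transfer (simp add: scaleC_add_left)
  show "c *\<^sub>C (d *\<^sub>C x) = (c * d) *\<^sub>C x"
    by transfer (simp add: scaleC_scaleC)
  show "1 *\<^sub>C x = x"
    by transfer (simp add: scaleC_one)
  show "r *\<^sub>R x = complex_of_real r *\<^sub>C x"
    by transfer (simp add: scaleR_scaleC)
qed

end

definition is_adjoint :: "('a::complex_hilbert \<Rightarrow>\<^sub>L 'b::complex_hilbert) \<Rightarrow> ('b \<Rightarrow>\<^sub>L 'a) \<Rightarrow> bool" where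
  "is_adjoint T S \<longleftrightarrow> (\<forall>x y. cinner (blinfun_apply T x) y = cinner x (blinfun_apply S y))"

definition psd_operator :: "('a::complex_hilbert \<Rightarrow>\<^sub>L 'a) \<Rightarrow> bool" where
  "psd_operator T \<longleftrightarrow> clinear_blinfun T \<and> is_adjoint T T \<and>
     (\<forall>x. cinner (blinfun_apply T x) x \<in> \<real>\<^sub>\<ge>\<^sub>0)"

definition is_inverse_operator :: "('a::complex_hilbert \<Rightarrow>\<^sub>L 'a) \<Rightarrow> ('a \<Rightarrow>\<^sub>L 'a) \<Rightarrow> bool" where
  "is_inverse_operator T S \<longleftrightarrow>
     clinear_blinfun S \<and> T o\<^sub>L S = id_blinfun \<and> S o\<^sub>L T = id_blinfun"

text \<open>The entries of the block matrix of an operator on \<open>'u \<oplus> 'h\<close>.\<close>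

lift_definition inl_blinfun :: "'a::real_normed_vector \<Rightarrow>\<^sub>L ('a \<times> 'b::real_normed_vector)"
  is "\<lambda>u. (u, 0)"
  by (intro bounded_linear_Pair bounded_linear_ident bounded_linear_zero)

lift_definition inr_blinfun :: "'b::real_normed_vector \<Rightarrow>\<^sub>L ('a::real_normed_vector \<times> 'b)"
  is "\<lambda>h. (0, h)"
  by (intro bounded_linear_Pair bounded_linear_ident bounded_linear_zero)

definition block_a :: "(('u::complex_hilbert \<times> 'h::complex_hilbert) \<Rightarrow>\<^sub>L ('u \<times> 'h)) \<Rightarrow> 'u \<Rightarrow>\<^sub>L 'u" where
  "block_a T = fst_blinfun o\<^sub>L T o\<^sub>L inl_blinfun"

definition block_b :: "(('u::complex_hilbert \<times> 'h::complex_hilbert) \<Rightarrow>\<^sub>L ('u \<times> 'h)) \<Rightarrow> 'h \<Rightarrow>\<^sub>L 'u" where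
  "block_b T = fst_blinfun o\<^sub>L T o\<^sub>L inr_blinfun"

definition block_c :: "(('u::complex_hilbert \<times> 'h::complex_hilbert) \<Rightarrow>\<^sub>L ('u \<times> 'h)) \<Rightarrow> 'u \<Rightarrow>\<^sub>L 'h" where
  "block_c T = snd_blinfun o\<^sub>L T o\<^sub>L inl_blinfun"

definition block_d :: "(('u::complex_hilbert \<times> 'h::complex_hilbert) \<Rightarrow>\<^sub>L ('u \<times> 'h)) \<Rightarrow> 'h \<Rightarrow>\<^sub>L 'h" where
  "block_d T = snd_blinfun o\<^sub>L T o\<^sub>L inr_blinfun"


section \<open>Domains, holomorphy and kernels\<close>

definition right_half_plane :: "complex set" where
  "right_half_plane = {z. Re z > 0}"

definition half_plane_power :: "(complex ^ 'n) set" where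
  "half_plane_power = {z. \<forall>k. z $ k \<in> right_half_plane}"

definition Omega :: "(complex ^ 'n) set" where
  "Omega = (\<Union>l\<in>sphere 0 1. {z. \<forall>k. z $ k \<in> (\<lambda>w. l * w) ` right_half_plane})"

text \<open>
  Both notions below are meant for an open set: complex Frechet differentiability with respect to
  the operator norm, the derivative being complex-linear, respectively conjugate-linear.
\<close>

definition holomorphic_op_on ::
  "(complex ^ 'n) set \<Rightarrow> (complex ^ 'n \<Rightarrow> 'u \<Rightarrow>\<^sub>L 'u::complex_hilbert) \<Rightarrow> bool" where
  "holomorphic_op_on S f \<longleftrightarrow>
     (\<forall>z\<in>S. clinear_blinfun (f z) \<and>
        (\<exists>D. (f has_derivative D) (at z) \<and> (\<forall>c v. D (c *s v) = c *\<^sub>C D v)))"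

definition antiholomorphic_op_on ::
  "(complex ^ 'n) set \<Rightarrow> (complex ^ 'n \<Rightarrow> 'u \<Rightarrow>\<^sub>L 'u::complex_hilbert) \<Rightarrow> bool" where
  "antiholomorphic_op_on S f \<longleftrightarrow>
     (\<forall>z\<in>S. clinear_blinfun (f z) \<and>
        (\<exists>D. (f has_derivative D) (at z) \<and> (\<forall>c v. D (c *s v) = cnj c *\<^sub>C D v)))"

definition holomorphic_psd_kernel ::
  "(complex ^ 'n) set \<Rightarrow> (complex ^ 'n \<Rightarrow> complex ^ 'n \<Rightarrow> 'u \<Rightarrow>\<^sub>L 'u::complex_hilbert) \<Rightarrow> bool" where
  "holomorphic_psd_kernel S \<Phi> \<longleftrightarrow>
     (\<forall>\<zeta>\<in>S. holomorphic_op_on S (\<lambda>z. \<Phi> z \<zeta>)) \<and>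
     (\<forall>z\<in>S. antiholomorphic_op_on S (\<lambda>\<zeta>. \<Phi> z \<zeta>)) \<and>
     (\<forall>z\<in>S. \<forall>\<zeta>\<in>S. is_adjoint (\<Phi> \<zeta> z) (\<Phi> z \<zeta>)) \<and>
     (\<forall>m (p :: nat \<Rightarrow> complex ^ 'n) (u :: nat \<Rightarrow> 'u). (\<forall>\<mu><m. p \<mu> \<in> S) \<longrightarrow>
        (\<Sum>\<mu><m. \<Sum>\<nu><m. cinner (blinfun_apply (\<Phi> (p \<mu>) (p \<nu>)) (u \<mu>)) (u \<nu>)) \<in> \<real>\<^sub>\<ge>\<^sub>0)"

text \<open>The identity \<open>f(z) = z\<^sub>1 \<Phi>\<^sub>1(z, \<zeta>) + \<dots> + z\<^sub>N \<Phi>\<^sub>N(z, \<zeta>)\<close> on \<open>S \<times> S\<close>.\<close>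

definition kernel_identity_on ::
  "(complex ^ 'n) set \<Rightarrow> (complex ^ 'n \<Rightarrow> 'u \<Rightarrow>\<^sub>L 'u::complex_hilbert) \<Rightarrow>
    ('n \<Rightarrow> complex ^ 'n \<Rightarrow> complex ^ 'n \<Rightarrow> 'u \<Rightarrow>\<^sub>L 'u) \<Rightarrow> bool" where
  "kernel_identity_on S f \<Phi> \<longleftrightarrow> (\<forall>z\<in>S. \<forall>\<zeta>\<in>S. f z = (\<Sum>k\<in>UNIV. (z $ k) *\<^sub>C \<Phi> k z \<zeta>))"

definition kernel_decomposition ::
  "(complex ^ 'n \<Rightarrow> 'u \<Rightarrow>\<^sub>L 'u::complex_hilbert) \<Rightarrow>
    ('n \<Rightarrow> complex ^ 'n \<Rightarrow> complex ^ 'n \<Rightarrow> 'u \<Rightarrow>\<^sub>L 'u) \<Rightarrow> bool" where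
  "kernel_decomposition f \<Phi> \<longleftrightarrow>
     (\<forall>k. holomorphic_psd_kernel half_plane_power (\<Phi> k)) \<and>
     kernel_identity_on half_plane_power f \<Phi>"


section \<open>The class of functions with a long resolvent representation\<close>

definition linear_pencil ::
  "('n::finite \<Rightarrow> 'a \<Rightarrow>\<^sub>L 'a::complex_hilbert) \<Rightarrow> complex ^ 'n \<Rightarrow> 'a \<Rightarrow>\<^sub>L 'a" where
  "linear_pencil A z = (\<Sum>k\<in>UNIV. (z $ k) *\<^sub>C A k)"

definition long_resolvent_representation ::
  "('n::finite \<Rightarrow> ('u::complex_hilbert \<times> 'h::complex_hilbert) \<Rightarrow>\<^sub>L ('u \<times> 'h)) \<Rightarrow>
    (complex ^ 'n \<Rightarrow> 'u \<Rightarrow>\<^sub>L 'u) \<Rightarrow> bool" where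
  "long_resolvent_representation A F \<longleftrightarrow>
     (\<forall>k. psd_operator (A k)) \<and>
     (\<forall>z\<in>Omega. \<exists>R. is_inverse_operator (block_d (linear_pencil A z)) R \<and>
        F z = block_a (linear_pencil A z)
              - (block_b (linear_pencil A z) o\<^sub>L R o\<^sub>L block_c (linear_pencil A z)))"

text \<open>
  Functions on \<^term>\<open>Omega\<close> having such a representation whose auxiliary space is the given
  Hilbert space \<open>'h\<close>.
\<close>

definition bessmertnyi_class_over ::
  "'h::complex_hilbert itself \<Rightarrow> (complex ^ 'n \<Rightarrow> 'u \<Rightarrow>\<^sub>L 'u::complex_hilbert) set" where
  "bessmertnyi_class_over _ = {F. holomorphic_op_on Omega F \<and>
     (\<exists>A :: 'n \<Rightarrow> ('u \<times> 'h) \<Rightarrow>\<^sub>L ('u \<times> 'h). long_resolvent_representation A F)}"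

text \<open>
  A formula of HOL cannot quantify over all Hilbert spaces \<open>'h\<close>, so the auxiliary space is taken
  to be an \<open>\<ell>\<^sup>2\<close> space of sufficiently large dimension. This loses no function. Given a representation
  over any \<open>'h\<close>, compress it to the closed subspace of \<open>'h\<close> that is generated from the vectors
  \<open>c(z) u\<close> by the lower right corners of the \<open>A k\<close>: it reduces these corners, and its dimension is at
  most the larger of \<open>\<aleph>\<^sub>0\<close> and the cardinality of \<open>'u\<close>, hence at most that of the index type below.
  A smaller auxiliary space can be enlarged by adding to every \<open>A k\<close> the identity operator of
  another Hilbert space, since the sum of the \<open>z\<^sub>k\<close> does not vanish on \<^term>\<open>Omega\<close>.
\<close>

definition bessmertnyi_class :: "(complex ^ 'n \<Rightarrow> 'u \<Rightarrow>\<^sub>L 'u::complex_hilbert) set" where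
  "bessmertnyi_class = bessmertnyi_class_over TYPE(('n \<times> (complex ^ 'n) \<times> 'u) ell2)"

text \<open>
  The extension of a function on \<^term>\<open>half_plane_power\<close> to \<^term>\<open>Omega\<close> by homogeneity of degree one.
  It need not exist, but its values on \<^term>\<open>Omega\<close> are unique.
\<close>

definition homogeneous_extension ::
  "(complex ^ 'n \<Rightarrow> 'u \<Rightarrow>\<^sub>L 'u::complex_hilbert) \<Rightarrow> (complex ^ 'n \<Rightarrow> 'u \<Rightarrow>\<^sub>L 'u) \<Rightarrow> bool" where
  "homogeneous_extension f F \<longleftrightarrow>
     (\<forall>z\<in>half_plane_power. F z = f z) \<and>
     (\<forall>l. l \<noteq> 0 \<longrightarrow> (\<forall>z\<in>Omega. F (l *s z) = l *\<^sub>C F z))"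

lemma Omega_obtain:
  assumes "z \<in> Omega"
  obtains l w where "cmod l = 1" "w \<in> half_plane_power" "z = l *s w"
proof -
  from assms obtain l where l: "cmod l = 1" "\<forall>k. z $ k \<in> (\<lambda>w. l * w) ` right_half_plane"
    by (auto simp: Omega_def)
  then have "\<forall>k. \<exists>w. w \<in> right_half_plane \<and> z $ k = l * w"
    by blast
  then obtain w where w: "\<forall>k. w k \<in> right_half_plane \<and> z $ k = l * w k"
    by metis
  show thesis
    by (rule that[of l "\<chi> k. w k"]) (use l w in \<open>auto simp: half_plane_power_def vec_eq_iff\<close>)
qed

lemma half_plane_power_subset_Omega: "half_plane_power \<subseteq> Omega"
  unfolding half_plane_power_def Omega_def by (auto intro!: bexI[of _ 1])

lemma homogeneous_extension_unique:
  assumes "homogeneous_extension f F" "homogeneous_extension f G" "z \<in> Omega"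
  shows "F z = G z"
proof -
  from \<open>z \<in> Omega\<close> obtain l w where *: "cmod l = 1" "w \<in> half_plane_power" "z = l *s w"
    by (rule Omega_obtain)
  then have "l \<noteq> 0" "w \<in> Omega"
    using half_plane_power_subset_Omega by auto
  with * assms show ?thesis
    by (simp add: homogeneous_extension_def)
qed

end

theory Submission
  imports Defs "HOL-Complex_Analysis.Conformal_Mappings"
begin

text \<open>
  From a representation to kernels. If \<open>f(z) = a(z) - b(z) d(z)\<inverse> c(z)\<close>, then the column
  \<open>\<psi>(z) = (1, - d(z)\<inverse> c(z))\<close> satisfies \<open>A(z) \<psi>(z) = (f(z), 0)\<close>. Since the first entry of \<open>\<psi>(\<zeta>)\<close> is
  the identity, \<open>\<psi>(\<zeta>)\<^sup>* A(z) \<psi>(z) = f(z)\<close> for every \<open>\<zeta>\<close>. Splitting \<open>A(z)\<close> into its terms \<open>z\<^sub>k A\<^sub>k\<close>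
  gives the kernels \<open>\<psi>(\<zeta>)\<^sup>* A\<^sub>k \<psi>(z)\<close>. They are defined on all of \<open>Omega\<close>, and they are homogeneous of degree
  zero because \<open>\<psi>\<close> is. This is the content of the locale \<open>invertible_pencil\<close>.

  From kernels to a representation. Factor \<open>\<Phi>\<^sub>k(z, \<zeta>) = H\<^sub>k(\<zeta>)\<^sup>* H\<^sub>k(z)\<close> with mutually orthogonal ranges for
  different \<open>k\<close>, let \<open>H\<close> be the sum of the \<open>H\<^sub>k\<close> and let \<open>Z\<close> act as \<open>z\<^sub>k\<close> on the range space of \<open>H\<^sub>k\<close>. The
  identity for \<open>f\<close> says that \<open>H(\<zeta>)\<^sup>* Z H(z) = f(z)\<close> does not depend on \<open>\<zeta>\<close>, that is, \<open>Z H(z)\<close> is orthogonal to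
  all increments \<open>H(\<zeta>) - H(1)\<close>. As \<open>H(z)\<close> is itself \<open>H(1)\<close> plus an increment, compressing \<open>Z\<close> to \<open>H(1)\<close>
  and the span of the increments produces a pencil with \<open>A(z) (1, H(z) - H(1)) = (f(z), 0)\<close>, hence a
  representation of \<open>f\<close>; see \<open>realization_of_decomposition\<close>. Its corner \<open>d(z)\<close> is invertible on \<open>Omega\<close>
  because it is coercive up to a rotation (\<open>coercive_invertible\<close>).

  In this representation \<open>\<psi>(z) = (1, H(z) - H(1))\<close>, and its kernels are the given ones. So the
  first part, applied to it, also extends the \<open>\<Phi>\<^sub>k\<close> to \<open>Omega\<close>. The extension is unique by the
  identity theorem on the punctured complex lines through the origin (\<open>holomorphic_psd_kernel_Omega_eqI\<close>).

  The factorisation of the kernels (\<open>Kolmogorov_decomposition\<close>) must take place in an \<open>\<ell>\<^sup>2\<close> space over the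
  index set of the kernel. A Cholesky factorisation along a well-order achieves this directly,
  without a reproducing kernel space and a count of its orthonormal basis.
\<close>

section \<open>Complex scalar products\<close>

lemma scaleC_zero_right [simp]: "c *\<^sub>C (0::'a::complex_vector) = 0"
  using scaleC_add_right[of c 0 "0::'a"] by simp

lemma scaleC_minus_right: "c *\<^sub>C (- x) = - (c *\<^sub>C (x::'a::complex_vector))"
  using scaleC_add_right[of c x "- x"] by (simp add: eq_neg_iff_add_eq_0 add.commute)

lemma scaleC_diff_right: "c *\<^sub>C (x - y) = c *\<^sub>C x - c *\<^sub>C (y::'a::complex_vector)"
  using scaleC_add_right[of c x "- y"] by (simp add: scaleC_minus_right)

lemma scaleC_sum_right: "c *\<^sub>C (\<Sum>i\<in>F. g i) = (\<Sum>i\<in>F. c *\<^sub>C (g i::'a::complex_vector))"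
  by (induction F rule: infinite_finite_induct) (simp_all add: scaleC_add_right)

lemma scaleC_scaleR: "c *\<^sub>C (r *\<^sub>R x) = r *\<^sub>R (c *\<^sub>C (x::'a::complex_vector))"
  by (simp add: scaleR_scaleC scaleC_scaleC mult.commute)

lemma cinner_add_right: "cinner x (y + z) = cinner x y + cinner x (z::'a::complex_hilbert)"
  by (subst (1 2 3) cinner_commute) (simp add: cinner_add_left)

lemma cinner_scaleC_right: "cinner x (c *\<^sub>C y) = cnj c * cinner x (y::'a::complex_hilbert)"
  by (subst (1 2) cinner_commute) (simp add: cinner_scaleC_left)

lemma Cauchy_Schwarz_cinner: "cmod (cinner x y) \<le> norm x * norm (y::'a::complex_hilbert)"
proof -
  obtain c where c: "cmod c = 1" "c * cinner x y = of_real (cmod (cinner x y))"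
  proof (cases "cinner x y = 0")
    case False
    show thesis
    proof (rule that)
      let ?c = "cnj (cinner x y) / of_real (cmod (cinner x y))"
      show "cmod ?c = 1"
        using False by (simp add: norm_divide)
      show "?c * cinner x y = of_real (cmod (cinner x y))"
        using False complex_norm_square[of "cinner x y"]
        by (simp add: power2_eq_square mult.commute field_simps)
    qed
  qed (rule that[of 1]; simp)
  have "cmod (cinner x y) = inner (c *\<^sub>C x) y"
    using c(2) by (simp add: inner_Re_cinner cinner_scaleC_left)
  also have "\<dots> \<le> norm (c *\<^sub>C x) * norm y"
    by (rule norm_cauchy_schwarz)
  finally show ?thesis
    using c(1) by (simp add: norm_scaleC)
qed

lemma bounded_bilinear_cinner:
  "bounded_bilinear (cinner :: 'a::complex_hilbert \<Rightarrow> 'a \<Rightarrow> complex)"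
proof
  show "cinner (r *\<^sub>R x) y = r *\<^sub>R cinner x y" for r and x y :: 'a
    by (simp add: scaleR_scaleC cinner_scaleC_left scaleR_conv_of_real)
  show "cinner x (r *\<^sub>R y) = r *\<^sub>R cinner x y" for r and x y :: 'a
    by (simp add: scaleR_scaleC cinner_scaleC_right scaleR_conv_of_real)
  show "\<exists>K. \<forall>x (y::'a). norm (cinner x y) \<le> norm x * norm y * K"
    by (rule exI[of _ 1]) (simp add: Cauchy_Schwarz_cinner)
qed (simp_all add: cinner_add_left cinner_add_right)

lemmas cinner_zero_left [simp] = bounded_bilinear.zero_left[OF bounded_bilinear_cinner]
lemmas cinner_zero_right [simp] = bounded_bilinear.zero_right[OF bounded_bilinear_cinner]
lemmas cinner_diff_left = bounded_bilinear.diff_left[OF bounded_bilinear_cinner]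
lemmas cinner_diff_right = bounded_bilinear.diff_right[OF bounded_bilinear_cinner]
lemmas cinner_sum_left = bounded_bilinear.sum_left[OF bounded_bilinear_cinner]
lemmas cinner_sum_right = bounded_bilinear.sum_right[OF bounded_bilinear_cinner]

lemma cinner_self_eq_0: "cinner x x = 0 \<longleftrightarrow> x = (0::'a::complex_hilbert)"
  by (simp add: cinner_self)

lemma cinner_self_nonneg: "cinner x (x::'a::complex_hilbert) \<in> \<real>\<^sub>\<ge>\<^sub>0"
  by (simp add: cinner_self)

lemma cinner_eq_swap: "cinner x y = cinner z w \<Longrightarrow> cinner y x = cinner w (z::'a::complex_hilbert)"
  by (subst (1 2) cinner_commute) simp

lemma cinner_0_swap: "cinner x y = 0 \<longleftrightarrow> cinner y (x::'a::complex_hilbert) = 0"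
  by (subst cinner_commute) simp

lemma cinner_ext:
  assumes "\<And>y. cinner x y = cinner x' (y::'a::complex_hilbert)"
  shows "x = x'"
  using assms[of "x - x'"] cinner_self_eq_0[of "x - x'"] by (simp add: cinner_diff_left)

text \<open>The imaginary part of \<open>\<langle>x, y\<rangle>\<close> is the real part of \<open>\<langle>- \<i> x, y\<rangle>\<close>.\<close>

lemma cinner_eqI_inner:
  assumes "\<And>c. inner (c *\<^sub>C x) y = inner (c *\<^sub>C x') (y'::'b::complex_hilbert)"
  shows "cinner x (y::'a::complex_hilbert) = cinner x' y'"
  using assms[of 1] assms[of \<i>]
  by (simp add: inner_Re_cinner cinner_scaleC_left complex_eq_iff)

section \<open>Orthogonal projections and adjoints\<close>

text \<open>
  A minimising sequence for the distance is Cauchy by the parallelogram law; its limit is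
  orthogonal because moving along the subspace cannot decrease the distance.
\<close>

lemma orthogonal_projection_exists:
  fixes S :: "'a::{real_inner, complete_space} set"
  assumes "closed S" "subspace S"
  obtains p where "p \<in> S" "\<And>y. y \<in> S \<Longrightarrow> inner (x - p) y = 0"
proof -
  define d where "d = infdist x S"
  have ne: "S \<noteq> {}"
    using subspace_0[OF \<open>subspace S\<close>] by blast
  have d_le: "d \<le> norm (x - y)" if "y \<in> S" for y
    using infdist_le[OF that, of x] by (simp add: d_def dist_norm)
  have d0: "d \<ge> 0"
    by (simp add: d_def infdist_nonneg)
  have "\<exists>y\<in>S. norm (x - y) < d + 1 / Suc n" for n
  proof -
    have "(INF y\<in>S. dist x y) < d + 1 / Suc n"
      using ne by (simp add: d_def infdist_notempty)
    then show ?thesis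
      by (subst (asm) cINF_less_iff) (auto simp: ne dist_norm intro: bdd_belowI2[of _ 0])
  qed
  then obtain Y where Y: "\<And>n. Y n \<in> S" "\<And>n. norm (x - Y n) < d + 1 / Suc n"
    by metis
  have par: "(norm (Y m - Y n))\<^sup>2 \<le> (2 * (4 * d + 2)) / Suc k" if "m \<ge> k" "n \<ge> k" for m n k
  proof -
    have mid: "(1/2) *\<^sub>R (Y m + Y n) \<in> S"
      using Y(1) assms(2) by (simp add: subspace_add subspace_scale)
    have "(norm (Y m - Y n))\<^sup>2 = 2 * (norm (x - Y m))\<^sup>2 + 2 * (norm (x - Y n))\<^sup>2
        - 4 * (norm (x - (1/2) *\<^sub>R (Y m + Y n)))\<^sup>2"
      by (simp add: power2_norm_eq_inner inner_diff inner_add inner_commute algebra_simps)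
    moreover have "(norm (x - Y j))\<^sup>2 \<le> d\<^sup>2 + (2 * d + 1) / Suc k" if "j \<ge> k" for j
    proof -
      have "1 / Suc j \<le> 1 / Suc k" "1 / Suc k \<le> (1::real)"
        using that by (simp_all add: frac_le)
      then have "(norm (x - Y j))\<^sup>2 \<le> (d + 1 / Suc k)\<^sup>2"
        using Y(2)[of j] by (intro power_mono norm_ge_zero) linarith
      also have "\<dots> = d\<^sup>2 + 2 * d * (1 / Suc k) + (1 / Suc k) * (1 / Suc k)"
        by (simp add: power2_eq_square algebra_simps)
      also have "\<dots> \<le> d\<^sup>2 + 2 * d * (1 / Suc k) + (1 / Suc k) * 1"
        by (intro add_left_mono mult_left_mono) (use \<open>1 / Suc k \<le> 1\<close> in auto)
      also have "\<dots> = d\<^sup>2 + (2 * d + 1) / Suc k"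
        by (simp add: add_divide_distrib)
      finally show ?thesis .
    qed
    note this[OF that(1)] this[OF that(2)]
    moreover have "d\<^sup>2 \<le> (norm (x - (1/2) *\<^sub>R (Y m + Y n)))\<^sup>2"
      by (intro power_mono d_le mid d0)
    moreover have "(2 * (4 * d + 2)) / Suc k = 4 * ((2 * d + 1) / Suc k)"
      by simp
    ultimately show ?thesis
      by linarith
  qed
  have "Cauchy Y"
  proof (rule metric_CauchyI)
    fix e :: real assume "e > 0"
    obtain k where "(2 * (4 * d + 2)) / e\<^sup>2 < real k"
      using reals_Archimedean2 by blast
    then have k: "(2 * (4 * d + 2)) / e\<^sup>2 < Suc k"
      by simp
    have "dist (Y m) (Y n) < e" if "m \<ge> k" "n \<ge> k" for m n
    proof -
      have "(2 * (4 * d + 2)) / Suc k < e\<^sup>2"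
        using k \<open>e > 0\<close> by (simp add: field_simps)
      then have "(norm (Y m - Y n))\<^sup>2 < e\<^sup>2"
        using par[OF that] by linarith
      then show ?thesis
        using \<open>e > 0\<close> by (simp add: dist_norm power2_less_imp_less)
    qed
    then show "\<exists>M. \<forall>m\<ge>M. \<forall>n\<ge>M. dist (Y m) (Y n) < e"
      by blast
  qed
  then obtain p where p: "Y \<longlonglongrightarrow> p"
    using Cauchy_convergent convergent_def by blast
  have "p \<in> S"
    using closed_sequentially[OF \<open>closed S\<close>] Y(1) p by blast
  have "norm (x - p) \<le> d"
  proof (rule LIMSEQ_le)
    show "(\<lambda>n. norm (x - Y n)) \<longlonglongrightarrow> norm (x - p)"
      by (intro tendsto_intros p)
    show "(\<lambda>n. d + 1 / Suc n) \<longlonglongrightarrow> d"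
      using tendsto_add[OF tendsto_const LIMSEQ_inverse_real_of_nat, of d] by (simp add: inverse_eq_divide)
    show "\<exists>N. \<forall>n\<ge>N. norm (x - Y n) \<le> d + 1 / Suc n"
      using Y(2) less_imp_le by blast
  qed
  have "inner (x - p) y = 0" if "y \<in> S" for y
  proof (cases "y = 0")
    case False
    define t where "t = inner (x - p) y / inner y y"
    have "p + t *\<^sub>R y \<in> S"
      using \<open>p \<in> S\<close> \<open>y \<in> S\<close> assms(2) by (simp add: subspace_add subspace_scale)
    then have "norm (x - p) \<le> norm (x - (p + t *\<^sub>R y))"
      using d_le \<open>norm (x - p) \<le> d\<close> order_trans by blast
    then have "inner (x - p) (x - p) \<le> inner (x - (p + t *\<^sub>R y)) (x - (p + t *\<^sub>R y))"
      by (simp add: norm_le)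
    also have "\<dots> = inner (x - p) (x - p) - 2 * t * inner (x - p) y + t * t * inner y y"
      by (simp add: inner_diff inner_add inner_commute algebra_simps)
    also have "\<dots> = inner (x - p) (x - p) - (inner (x - p) y)\<^sup>2 / inner y y"
      using False by (simp add: t_def power2_eq_square field_simps)
    finally have "(inner (x - p) y)\<^sup>2 / inner y y \<le> 0"
      by simp
    moreover have "inner y y > 0"
      using False by simp
    ultimately have "(inner (x - p) y)\<^sup>2 \<le> 0"
      by (metis divide_le_0_iff linorder_not_less)
    then show ?thesis
      by simp
  qed simp
  with \<open>p \<in> S\<close> show thesis
    by (rule that)
qed

text \<open>
  The given set is the graph of a bounded functional on a subspace. Projecting \<open>(0, 1)\<close> onto it and
  rescaling yields the Riesz representer of the functional, which lies in its domain.
\<close>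

lemma bounded_graph_representer:
  fixes G :: "('a::{real_inner, complete_space} \<times> real) set"
  assumes "closed G" "subspace G"
    and bound: "\<And>x t. (x, t) \<in> G \<Longrightarrow> t\<^sup>2 \<le> C * (norm x)\<^sup>2" and "C \<ge> 0"
  obtains p where "p \<in> fst ` G" "\<And>x t. (x, t) \<in> G \<Longrightarrow> t = inner x p" "(norm p)\<^sup>2 \<le> C"
proof -
  obtain q where q: "q \<in> G" "\<And>y. y \<in> G \<Longrightarrow> inner ((0, 1) - q) y = 0"
    using orthogonal_projection_exists[OF assms(1,2), of "(0, 1)"] by blast
  obtain q1 t where qt: "q = (q1, t)"
    by force
  have rel: "inner x q1 = s * (1 - t)" if "(x, s) \<in> G" for x s
    using q(2)[OF that] by (simp add: qt inner_commute algebra_simps)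
  have "t \<noteq> 1"
  proof
    assume "t = 1"
    then have "q1 = 0" using rel[of q1 t] q(1) qt by simp
    then show False using bound[of q1 t] q(1) qt \<open>t = 1\<close> by simp
  qed
  define p where "p = (1 / (1 - t)) *\<^sub>R q1"
  have pG: "(p, t / (1 - t)) \<in> G"
    using subspace_scale[OF assms(2) q(1), of "1 / (1 - t)"] by (simp add: p_def qt)
  have rep: "s = inner x p" if "(x, s) \<in> G" for x s
    using rel[OF that] \<open>t \<noteq> 1\<close> by (simp add: p_def)
  have "((norm p)\<^sup>2)\<^sup>2 \<le> C * (norm p)\<^sup>2"
    using bound[OF pG] rep[OF pG] by (simp add: power2_norm_eq_inner)
  then have "(norm p)\<^sup>2 \<le> C"
    using \<open>C \<ge> 0\<close> by (cases "p = 0") (simp_all add: power2_eq_square)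
  then show thesis
    using that[OF _ rep] pG by force
qed

lemma Riesz_representation:
  fixes \<phi> :: "'a::{real_inner, complete_space} \<Rightarrow> real"
  assumes "bounded_linear \<phi>"
  obtains p where "\<And>x. \<phi> x = inner x p" "norm p \<le> onorm \<phi>"
proof -
  interpret bounded_linear \<phi> by fact
  have "closed (range (\<lambda>x. (x, \<phi> x)))"
  proof -
    have "closed {q. snd q = \<phi> (fst q)}"
      by (intro closed_Collect_eq continuous_intros continuous_on)
    also have "{q. snd q = \<phi> (fst q)} = range (\<lambda>x. (x, \<phi> x))"
      by force
    finally show ?thesis .
  qed
  moreover have "subspace (range (\<lambda>x. (x, \<phi> x)))"
    by (intro linear_subspace_image subspace_UNIV bounded_linear.linear
      bounded_linear_Pair bounded_linear_ident assms)
  moreover have "t\<^sup>2 \<le> (onorm \<phi>)\<^sup>2 * (norm x)\<^sup>2" if "(x, t) \<in> range (\<lambda>x. (x, \<phi> x))" for x t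
    using that power_mono[OF onorm[OF assms, of x], of 2] by (auto simp: power_mult_distrib)
  ultimately obtain p where "\<And>x t. (x, t) \<in> range (\<lambda>x. (x, \<phi> x)) \<Longrightarrow> t = inner x p"
    "(norm p)\<^sup>2 \<le> (onorm \<phi>)\<^sup>2"
    by (rule bounded_graph_representer) auto
  then show thesis
    using onorm_pos_le[OF assms] by (intro that) (auto intro: power2_le_imp_le)
qed

lemma clinear_blinfunD: "clinear_blinfun T \<Longrightarrow> blinfun_apply T (c *\<^sub>C x) = c *\<^sub>C blinfun_apply T x"
  by (simp add: clinear_blinfun_def)

lemma is_adjointD:
  "is_adjoint T S \<Longrightarrow> cinner (blinfun_apply T x) y = cinner x (blinfun_apply S y)"
  by (simp add: is_adjoint_def)

lemma is_adjointD':
  "is_adjoint T S \<Longrightarrow> cinner (blinfun_apply S y) x = cinner y (blinfun_apply T x)"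
  by (rule cinner_eq_swap[symmetric, OF is_adjointD])

text \<open>
  Linearity follows from the defining relation of the adjoint alone, so it is available before \<open>S\<close> is
  known to be bounded.
\<close>

lemma formal_adjoint_linear:
  fixes S :: "'b::complex_hilbert \<Rightarrow> 'a::complex_hilbert"
  assumes "\<And>x y. cinner (T x) y = cinner x (S y)"
  shows "S (y + z) = S y + S z" "S (c *\<^sub>C y) = c *\<^sub>C S y"
proof -
  have *: "cinner (S y) x = cinner y (T x)" for x y
    by (rule cinner_eq_swap[symmetric, OF assms])
  show "S (y + z) = S y + S z"
    by (rule cinner_ext) (simp add: * cinner_add_left)
  show "S (c *\<^sub>C y) = c *\<^sub>C S y"
    by (rule cinner_ext) (simp add: * cinner_scaleC_left)
qed

lemma adjoint_clinear: "is_adjoint T S \<Longrightarrow> clinear_blinfun S"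
  unfolding clinear_blinfun_def by (meson formal_adjoint_linear(2) is_adjointD)

text \<open>
  The Riesz theorem for the underlying real space yields \<open>S\<close>; complex linearity of \<open>T\<close> upgrades the
  real adjoint relation to the complex one.
\<close>

lemma adjoint_exists:
  fixes T :: "'a::complex_hilbert \<Rightarrow>\<^sub>L 'b::complex_hilbert"
  assumes "clinear_blinfun T"
  obtains S where "is_adjoint T S"
proof -
  have "\<exists>p. (\<forall>x. inner (blinfun_apply T x) y = inner x p) \<and> norm p \<le> norm y * norm T" for y
  proof -
    have bl: "bounded_linear (\<lambda>x. inner (blinfun_apply T x) y)"
      by (intro bounded_linear_inner_left_comp blinfun.bounded_linear_right)
    obtain p where p: "\<And>x. inner (blinfun_apply T x) y = inner x p"
      "norm p \<le> onorm (\<lambda>x. inner (blinfun_apply T x) y)"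
      using Riesz_representation[OF bl] by blast
    have "onorm (\<lambda>x. inner (blinfun_apply T x) y) \<le> norm y * norm T"
    proof (rule onorm_bound)
      fix x
      have "\<bar>inner (blinfun_apply T x) y\<bar> \<le> norm (blinfun_apply T x) * norm y"
        by (rule Cauchy_Schwarz_ineq2)
      also have "\<dots> \<le> (norm T * norm x) * norm y"
        by (intro mult_right_mono norm_blinfun) simp
      finally show "norm (inner (blinfun_apply T x) y) \<le> norm y * norm T * norm x"
        by (simp add: algebra_simps)
    qed simp
    with p show ?thesis by fastforce
  qed
  then obtain S where S: "\<And>x y. inner (blinfun_apply T x) y = inner x (S y)"
    and bound: "\<And>y. norm (S y) \<le> norm y * norm T"
    by metis
  have cS: "cinner (blinfun_apply T x) y = cinner x (S y)" for x y
    by (rule cinner_eqI_inner) (simp add: S flip: clinear_blinfunD[OF assms])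
  have "bounded_linear S"
    using formal_adjoint_linear[OF cS]
    by (intro bounded_linear_intro[of _ "norm T"] bound) (simp_all add: scaleR_scaleC)
  then show thesis
    by (intro that[of "Blinfun S"]) (simp add: is_adjoint_def cS bounded_linear_Blinfun_apply)
qed

text \<open>
  The closed complex span of \<open>B\<close> is represented by the double orthogonal complement of \<open>B\<close>. In this
  form a linear relation passes from \<open>B\<close> to its closed span without a limit argument.
\<close>

definition orthocomplement :: "'a::complex_hilbert set \<Rightarrow> 'a set" where
  "orthocomplement B = {x. \<forall>b\<in>B. cinner x b = 0}"

lemma closed_orthocomplement: "closed (orthocomplement B)"
proof -
  have "orthocomplement B = (\<Inter>b\<in>B. {x. cinner x b = 0})"
    by (auto simp: orthocomplement_def)
  then show ?thesis
    by (auto intro!: closed_INT closed_Collect_eq continuous_intros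
        linear_continuous_on bounded_bilinear.bounded_linear_left[OF bounded_bilinear_cinner])
qed

lemma subspace_orthocomplement: "subspace (orthocomplement B)"
  by (rule subspaceI) (simp_all add: orthocomplement_def cinner_add_left scaleR_scaleC cinner_scaleC_left)

lemma orthocomplement_scaleC: "x \<in> orthocomplement B \<Longrightarrow> c *\<^sub>C x \<in> orthocomplement B"
  by (simp add: orthocomplement_def cinner_scaleC_left)

lemma subset_double_complement: "B \<subseteq> orthocomplement (orthocomplement B)"
  by (auto simp: orthocomplement_def cinner_0_swap)

lemma double_complement_orthogonal:
  "x \<in> orthocomplement (orthocomplement B) \<Longrightarrow> y \<in> orthocomplement B \<Longrightarrow> cinner x y = 0 \<and> cinner y x = 0"
  using cinner_0_swap[of x y] by (auto simp: orthocomplement_def)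

definition is_span_projection :: "'a::complex_hilbert set \<Rightarrow> ('a \<Rightarrow>\<^sub>L 'a) \<Rightarrow> bool" where
  "is_span_projection B Q \<longleftrightarrow> clinear_blinfun Q \<and> is_adjoint Q Q \<and>
     (\<forall>x. blinfun_apply Q x \<in> orthocomplement (orthocomplement B)) \<and> (\<forall>x. x - blinfun_apply Q x \<in> orthocomplement B)"

text \<open>
  The nearest point in the real Hilbert space already has a residual orthogonal to the complex
  subspace, since the subspace is invariant under multiplication by \<open>\<i>\<close>. The resulting map satisfies
  \<open>\<langle>Q x, y\<rangle> = \<langle>Q x, Q y\<rangle> = \<langle>x, Q y\<rangle>\<close>, which makes it linear.
\<close>

lemma span_projection_exists:
  fixes B :: "'a::complex_hilbert set"
  obtains Q where "is_span_projection B Q"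
proof -
  have "\<exists>p. p \<in> orthocomplement (orthocomplement B) \<and> x - p \<in> orthocomplement B" for x
  proof -
    obtain p where p: "p \<in> orthocomplement (orthocomplement B)" "\<And>y. y \<in> orthocomplement (orthocomplement B) \<Longrightarrow> inner (x - p) y = 0"
      using orthogonal_projection_exists[OF closed_orthocomplement subspace_orthocomplement] by blast
    have "cinner (x - p) b = cinner 0 b" if "b \<in> B" for b
    proof (rule cinner_eq_swap, rule cinner_eqI_inner)
      show "inner (c *\<^sub>C b) (x - p) = inner (c *\<^sub>C b) 0" for c
        using p(2)[OF orthocomplement_scaleC[OF subsetD[OF subset_double_complement that]]]
        by (simp add: inner_commute)
    qed
    with p(1) show ?thesis
      by (auto simp: orthocomplement_def)
  qed
  then obtain Q where Q: "\<And>x. Q x \<in> orthocomplement (orthocomplement B)" "\<And>x. x - Q x \<in> orthocomplement B"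
    by metis
  have QQ: "cinner (x - Q x) (Q y) = 0" "cinner (Q y) (x - Q x) = 0" for x y
    using double_complement_orthogonal[OF Q(1) Q(2)] by auto
  have adj: "cinner (Q x) y = cinner x (Q y)" for x y
    using QQ(1)[of x y] QQ(2)[of x y] QQ(2)[of y x] by (simp add: cinner_diff_left cinner_diff_right)
  have bound: "norm (Q x) \<le> norm x * 1" for x
  proof -
    have "(norm (Q x))\<^sup>2 = inner x (Q x)"
      using QQ(1)[of x x] by (simp add: cinner_diff_left inner_Re_cinner power2_norm_eq_inner)
    also have "\<dots> \<le> norm x * norm (Q x)"
      by (rule norm_cauchy_schwarz)
    finally show ?thesis
      by (cases "Q x = 0") (simp_all add: power2_eq_square)
  qed
  have "bounded_linear Q"
    using formal_adjoint_linear[OF adj] by (intro bounded_linear_intro[OF _ _ bound]) (simp_all add: scaleR_scaleC)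
  then have "is_span_projection B (Blinfun Q)"
    using Q adj formal_adjoint_linear(2)[OF adj]
    by (simp add: is_span_projection_def clinear_blinfun_def is_adjoint_def bounded_linear_Blinfun_apply)
  then show thesis
    by (rule that)
qed

lemma span_projection_fixes:
  assumes "is_span_projection B Q" "x \<in> orthocomplement (orthocomplement B)"
  shows "blinfun_apply Q x = x"
proof -
  have "x - blinfun_apply Q x \<in> orthocomplement (orthocomplement B)" "x - blinfun_apply Q x \<in> orthocomplement B"
    using assms subspace_diff[OF subspace_orthocomplement] by (auto simp: is_span_projection_def)
  from double_complement_orthogonal[OF this] show ?thesis
    by (simp add: cinner_self_eq_0)
qed

lemma span_projection_kills:
  assumes "is_span_projection B Q" "x \<in> orthocomplement B"
  shows "blinfun_apply Q x = 0"
proof -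
  have "blinfun_apply Q x \<in> orthocomplement (orthocomplement B)" "blinfun_apply Q x \<in> orthocomplement B"
    using assms subspace_diff[OF subspace_orthocomplement, of x B "x - blinfun_apply Q x"]
    by (simp_all add: is_span_projection_def)
  from double_complement_orthogonal[OF this] show ?thesis
    by (simp add: cinner_self_eq_0)
qed

section \<open>Coercive operators\<close>

lemma is_inverse_operator_apply:
  assumes "is_inverse_operator T S"
  shows "blinfun_apply T (blinfun_apply S x) = x" "blinfun_apply S (blinfun_apply T x) = x"
  using assms by (metis is_inverse_operator_def blinfun_apply_blinfun_compose id_blinfun.rep_eq id_apply)+

lemma is_inverse_operatorI:
  assumes "clinear_blinfun S" "\<And>x. blinfun_apply T (blinfun_apply S x) = x"
    "\<And>x. blinfun_apply S (blinfun_apply T x) = x"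
  shows "is_inverse_operator T S"
  using assms by (auto simp: is_inverse_operator_def intro!: blinfun_eqI)

lemma is_inverse_operator_unique:
  "is_inverse_operator T R \<Longrightarrow> is_inverse_operator T S \<Longrightarrow> R = S"
  by (rule blinfun_eqI) (metis is_inverse_operator_apply)

text \<open>
  Solving \<open>T x = y\<close> amounts to finding a fixed point of \<open>x - t w (T x - y)\<close>. Coercivity makes
  this map a contraction for \<open>t = c / M\<^sup>2\<close>, where \<open>M\<close> is a bound for the norm of \<open>w T\<close>. The summand \<open>c\<close> in \<open>M\<close>
  keeps \<open>t\<close> meaningful when \<open>w T = 0\<close>, which coercivity allows on the zero space.
\<close>

lemma coercive_invertible:
  fixes T :: "'a::complex_hilbert \<Rightarrow>\<^sub>L 'a"
  assumes lin: "clinear_blinfun T" and "c > 0"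
    and coercive: "\<And>x. c * (norm x)\<^sup>2 \<le> Re (w * cinner (blinfun_apply T x) x)"
  obtains R where "is_inverse_operator T R"
proof -
  define M where "M = cmod w * norm T + c"
  have M: "M > 0" "c \<le> M"
    using \<open>c > 0\<close> by (auto simp: M_def add_nonneg_pos)
  define t where "t = c / M\<^sup>2"
  have t: "t > 0" "t * M\<^sup>2 = c"
    using M \<open>c > 0\<close> by (simp_all add: t_def)
  define q where "q = 1 - t * c"
  have "t * c \<le> 1"
    using power_mono[OF M(2), of 2] M \<open>c > 0\<close> by (simp add: t_def power2_eq_square)
  moreover have "t * c > 0"
    using t \<open>c > 0\<close> by simp
  ultimately have q: "0 \<le> q" "q < 1"
    by (simp_all add: q_def)
  have Tle: "norm (w *\<^sub>C blinfun_apply T x) \<le> M * norm x" for x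
  proof -
    have "norm (w *\<^sub>C blinfun_apply T x) \<le> cmod w * (norm T * norm x)"
      by (simp add: norm_scaleC mult_left_mono norm_blinfun)
    moreover have "0 \<le> c * norm x"
      using \<open>c > 0\<close> by simp
    ultimately show ?thesis
      unfolding M_def distrib_right mult.assoc by linarith
  qed
  have expand: "(norm (x - r *\<^sub>R y))\<^sup>2 = (norm x)\<^sup>2 - 2 * r * inner y x + r\<^sup>2 * (norm y)\<^sup>2"
    for r and x y :: 'a
    unfolding power2_norm_eq_inner
    by (simp add: inner_diff inner_commute algebra_simps power2_eq_square)
  have contract: "norm (x - t *\<^sub>R (w *\<^sub>C blinfun_apply T x)) \<le> sqrt q * norm x" for x
  proof -
    let ?y = "w *\<^sub>C blinfun_apply T x"
    have "(norm (x - t *\<^sub>R ?y))\<^sup>2 = (norm x)\<^sup>2 - 2 * t * inner ?y x + t\<^sup>2 * (norm ?y)\<^sup>2"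
      by (rule expand)
    also have "\<dots> \<le> (norm x)\<^sup>2 - 2 * t * (c * (norm x)\<^sup>2) + t\<^sup>2 * (M * norm x)\<^sup>2"
      using coercive[of x] t Tle[of x]
      by (intro add_mono diff_mono mult_left_mono power_mono)
        (auto simp: inner_Re_cinner cinner_scaleC_left)
    also have "\<dots> = (norm x)\<^sup>2 - 2 * t * (c * (norm x)\<^sup>2) + t * (t * M\<^sup>2) * (norm x)\<^sup>2"
      by (simp add: power2_eq_square)
    also have "\<dots> = q * (norm x)\<^sup>2"
      unfolding t(2) q_def by (simp add: algebra_simps)
    finally have "(norm (x - t *\<^sub>R ?y))\<^sup>2 \<le> (sqrt q * norm x)\<^sup>2"
      using q by (simp add: power_mult_distrib)
    then show ?thesis
      by (rule power2_le_imp_le) (use q in simp)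
  qed
  have "\<exists>x. blinfun_apply T x = y" for y
  proof -
    have "\<exists>!x. x - t *\<^sub>R (w *\<^sub>C (blinfun_apply T x - y)) = x"
    proof (rule banach_fix_type[of "sqrt q"], use q in simp, use q in simp, intro allI)
      fix u v
      have "dist (u - t *\<^sub>R (w *\<^sub>C (blinfun_apply T u - y)))
         (v - t *\<^sub>R (w *\<^sub>C (blinfun_apply T v - y)))
         = norm ((u - v) - t *\<^sub>R (w *\<^sub>C blinfun_apply T (u - v)))"
        by (simp add: dist_norm blinfun.diff_right scaleC_diff_right algebra_simps)
      then show "dist (u - t *\<^sub>R (w *\<^sub>C (blinfun_apply T u - y)))
         (v - t *\<^sub>R (w *\<^sub>C (blinfun_apply T v - y))) \<le> sqrt q * dist u v"
        using contract[of "u - v"] by (simp add: dist_norm)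
    qed
    then obtain x where "t *\<^sub>R (w *\<^sub>C (blinfun_apply T x - y)) = 0"
      by auto
    then have "w *\<^sub>C (blinfun_apply T x - y) = 0"
      using t by simp
    then have "cmod w * norm (blinfun_apply T x - y) = 0"
      using norm_scaleC[of w "blinfun_apply T x - y"] by simp
    moreover have "y = 0" if "w = 0"
      using coercive[of y] \<open>c > 0\<close> that by (simp add: mult_le_0_iff)
    ultimately have "blinfun_apply T x = y \<or> blinfun_apply T 0 = y"
      by auto
    then show ?thesis
      by blast
  qed
  then have "\<exists>S. \<forall>y. blinfun_apply T (S y) = y"
    by (intro choice allI)
  then obtain S where S: "\<And>y. blinfun_apply T (S y) = y"
    by blast
  have below: "norm x \<le> norm (blinfun_apply T x) * (cmod w / c)" for x
  proof -
    have "c * (norm x)\<^sup>2 \<le> cmod (w * cinner (blinfun_apply T x) x)"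
      using coercive[of x] complex_Re_le_cmod order_trans by blast
    also have "\<dots> \<le> cmod w * (norm (blinfun_apply T x) * norm x)"
      by (simp add: norm_mult mult_left_mono Cauchy_Schwarz_cinner)
    finally have "c * norm x * norm x \<le> cmod w * norm (blinfun_apply T x) * norm x"
      by (simp add: power2_eq_square algebra_simps)
    then show ?thesis
      using \<open>c > 0\<close> by (cases "x = 0") (simp_all add: field_simps)
  qed
  have inj: "x = y" if "blinfun_apply T x = blinfun_apply T y" for x y
    using below[of "x - y"] that by (simp add: blinfun.diff_right)
  have "bounded_linear S"
  proof (rule bounded_linear_intro)
    show "S (x + y) = S x + S y" for x y
      by (rule inj) (simp add: S blinfun.add_right)
    show "S (r *\<^sub>R x) = r *\<^sub>R S x" for r x
      by (rule inj) (simp add: S blinfun.scaleR_right)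
    show "norm (S x) \<le> norm x * (cmod w / c)" for x
      using below[of "S x"] by (simp add: S)
  qed
  moreover have "S (z *\<^sub>C x) = z *\<^sub>C S x" for z x
    by (rule inj) (simp add: S clinear_blinfunD[OF lin])
  moreover have "S (blinfun_apply T x) = x" for x
    by (rule inj) (simp add: S)
  ultimately have "is_inverse_operator T (Blinfun S)"
    by (intro is_inverse_operatorI) (simp_all add: clinear_blinfun_def bounded_linear_Blinfun_apply S)
  then show thesis
    by (rule that)
qed

section \<open>Kolmogorov decomposition\<close>

lemma subspace_closure:
  fixes S :: "'a::real_normed_vector set"
  assumes "subspace S"
  shows "subspace (closure S)"
proof (rule subspaceI)
  show "0 \<in> closure S"
    using subspace_0[OF assms] closure_subset by blast
  show "x + y \<in> closure S" if xy: "x \<in> closure S" "y \<in> closure S" for x y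
  proof -
    obtain u v where "\<And>n. u n \<in> S" "u \<longlonglongrightarrow> x" "\<And>n. v n \<in> S" "v \<longlonglongrightarrow> y"
      using xy by (auto simp: closure_sequential)
    then show ?thesis
      unfolding closure_sequential
      by (intro exI[of _ "\<lambda>n. u n + v n"]) (auto intro: tendsto_add subspace_add[OF assms])
  qed
  show "c *\<^sub>R x \<in> closure S" if x: "x \<in> closure S" for c x
  proof -
    obtain u where "\<And>n. u n \<in> S" "u \<longlonglongrightarrow> x"
      using x by (auto simp: closure_sequential)
    then show ?thesis
      unfolding closure_sequential
      by (intro exI[of _ "\<lambda>n. c *\<^sub>R u n"]) (auto intro: tendsto_scaleR subspace_scale[OF assms])
  qed
qed

definition psd_scalar_kernel :: "('i \<Rightarrow> 'i \<Rightarrow> complex) \<Rightarrow> bool" where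
  "psd_scalar_kernel K \<longleftrightarrow> (\<forall>i j. K i j = cnj (K j i)) \<and>
     (\<forall>m (p :: nat \<Rightarrow> 'i) c. (\<Sum>\<mu><m. \<Sum>\<nu><m. c \<mu> * cnj (c \<nu>) * K (p \<mu>) (p \<nu>)) \<in> \<real>\<^sub>\<ge>\<^sub>0)"

lemma psd_scalar_kernel_hermitian: "psd_scalar_kernel K \<Longrightarrow> K i j = cnj (K j i)"
  by (rule conjunct1[OF iffD1[OF psd_scalar_kernel_def], rule_format])

lemma psd_scalar_kernel_nonneg:
  "psd_scalar_kernel K \<Longrightarrow> (\<Sum>\<mu><m::nat. \<Sum>\<nu><m. c \<mu> * cnj (c \<nu>) * K (p \<mu>) (p \<nu>)) \<in> \<real>\<^sub>\<ge>\<^sub>0"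
  by (rule conjunct2[OF iffD1[OF psd_scalar_kernel_def], rule_format])

lemma psd_scalar_kernel_diagonal:
  assumes "psd_scalar_kernel K"
  shows "K i i = of_real (Re (K i i))" "Re (K i i) \<ge> 0"
proof -
  have "K i i \<in> \<real>\<^sub>\<ge>\<^sub>0"
    using psd_scalar_kernel_nonneg[OF assms, where m = "Suc 0" and c = "\<lambda>_. 1" and p = "\<lambda>_. i"] by simp
  then show "K i i = of_real (Re (K i i))" "Re (K i i) \<ge> 0"
    by (simp_all add: complex_nonneg_Reals_iff complex_eq_iff)
qed

text \<open>
  The bound of the Cauchy-Schwarz inequality, in a form that remains meaningful when the leading
  coefficient vanishes.
\<close>

lemma nonneg_quadratic_discriminant:
  fixes a b c :: real
  assumes "\<And>s. 0 \<le> a + 2 * s * b + s\<^sup>2 * c" "c \<ge> 0"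
  shows "b\<^sup>2 \<le> c * a"
proof (cases "c = 0")
  case True
  have "b = 0"
  proof (rule ccontr)
    assume "b \<noteq> 0"
    then have "2 * (- (a + 1) / (2 * b)) * b = - (a + 1)"
      by simp
    then show False
      using assms(1)[of "- (a + 1) / (2 * b)"] True by simp
  qed
  then show ?thesis using True by simp
next
  case False
  then show ?thesis
    using assms(1)[of "- b / c"] assms(2) by (simp add: power2_eq_square field_simps)
qed

text \<open>
  The kernel prescribes a functional on the span of the vectors already chosen, and positivity for
  one more index says that its square is bounded by \<open>K i i\<close>; the vector obtained is its representer.
\<close>

lemma psd_scalar_kernel_representer:
  fixes f :: "'i \<Rightarrow> 'h::complex_hilbert"
  assumes K: "psd_scalar_kernel K"
    and gram: "\<And>j k. j \<in> J \<Longrightarrow> k \<in> J \<Longrightarrow> cinner (f j) (f k) = K j k"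
  obtains p where "\<And>j. j \<in> J \<Longrightarrow> cinner (f j) p = K j i" "(norm p)\<^sup>2 \<le> Re (K i i)"
    "p \<in> orthocomplement (orthocomplement (f ` J))"
proof -
  define B where "B = {(c *\<^sub>C f j, Re (c * K j i)) | c j. j \<in> J}"
  define G where "G = closure (span B)"
  \<comment> \<open>Indices may repeat in such a combination, so a step of the induction just appends a term.\<close>
  have comb: "\<exists>(m::nat) p d. (\<forall>\<mu><m. p \<mu> \<in> J) \<and>
      q = (\<Sum>\<mu><m. d \<mu> *\<^sub>C f (p \<mu>), Re (\<Sum>\<mu><m. d \<mu> * K (p \<mu>) i))"
    if "q \<in> span B" for q
    using that
  proof (induction rule: span_induct_alt)
    case base
    show ?case
      by (rule exI[of _ "0::nat"]) (simp add: zero_prod_def)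
  next
    case (step r b q)
    then obtain m :: nat and p d where *: "\<forall>\<mu><m. p \<mu> \<in> J"
      "q = (\<Sum>\<mu><m. d \<mu> *\<^sub>C f (p \<mu>), Re (\<Sum>\<mu><m. d \<mu> * K (p \<mu>) i))"
      by blast
    from step(1) obtain c j where "j \<in> J" "b = (c *\<^sub>C f j, Re (c * K j i))"
      by (auto simp: B_def)
    with * show ?case
      by (intro exI[of _ "Suc m"] exI[of _ "p(m := j)"] exI[of _ "d(m := of_real r * c)"])
        (auto simp: less_Suc_eq scaleR_scaleC scaleC_scaleC algebra_simps)
  qed
  have "t\<^sup>2 \<le> Re (K i i) * (norm x)\<^sup>2" if xt: "(x, t) \<in> span B" for x t
  proof -
    obtain m :: nat and p d where p: "\<forall>\<mu><m. p \<mu> \<in> J" and x: "x = (\<Sum>\<mu><m. d \<mu> *\<^sub>C f (p \<mu>))"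
      and t: "t = Re (\<Sum>\<mu><m. d \<mu> * K (p \<mu>) i)"
      using comb[OF xt] by auto
    have xx: "cinner x x = (\<Sum>\<mu><m. \<Sum>\<nu><m. d \<mu> * cnj (d \<nu>) * K (p \<mu>) (p \<nu>))"
    proof -
      have "cinner x x = (\<Sum>\<mu><m. \<Sum>\<nu><m. cinner (d \<mu> *\<^sub>C f (p \<mu>)) (d \<nu> *\<^sub>C f (p \<nu>)))"
        by (simp only: x cinner_sum_left) (simp only: cinner_sum_right)
      then show ?thesis
        using p by (simp add: cinner_scaleC_left cinner_scaleC_right gram mult.assoc mult.left_commute)
    qed
    show ?thesis
    proof (rule nonneg_quadratic_discriminant)
      fix s :: real
      define c where "c = d(m := of_real s)"
      define r where "r = p(m := i)"
      have "(\<Sum>\<mu><Suc m. \<Sum>\<nu><Suc m. c \<mu> * cnj (c \<nu>) * K (r \<mu>) (r \<nu>)) \<in> \<real>\<^sub>\<ge>\<^sub>0"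
        by (rule psd_scalar_kernel_nonneg[OF K])
      also have "(\<Sum>\<mu><Suc m. \<Sum>\<nu><Suc m. c \<mu> * cnj (c \<nu>) * K (r \<mu>) (r \<nu>))
          = cinner x x + of_real s * (\<Sum>\<mu><m. d \<mu> * K (p \<mu>) i)
            + of_real s * (\<Sum>\<nu><m. cnj (d \<nu>) * K i (p \<nu>)) + of_real s * of_real s * K i i"
      proof -
        have last: "(\<Sum>\<nu><m. of_real s * cnj (d \<nu>) * K i (p \<nu>))
            = of_real s * (\<Sum>\<nu><m. cnj (d \<nu>) * K i (p \<nu>))"
          "(\<Sum>\<mu><m. d \<mu> * of_real s * K (p \<mu>) i) = of_real s * (\<Sum>\<mu><m. d \<mu> * K (p \<mu>) i)"
          by (simp_all add: sum_distrib_left mult.assoc mult.left_commute)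
        have "(\<Sum>\<mu><Suc m. \<Sum>\<nu><Suc m. c \<mu> * cnj (c \<nu>) * K (r \<mu>) (r \<nu>))
            = (\<Sum>\<mu><m. (\<Sum>\<nu><m. d \<mu> * cnj (d \<nu>) * K (p \<mu>) (p \<nu>)) + d \<mu> * of_real s * K (p \<mu>) i)
              + ((\<Sum>\<nu><m. of_real s * cnj (d \<nu>) * K i (p \<nu>)) + of_real s * of_real s * K i i)"
          by (simp add: c_def r_def)
        then show ?thesis
          by (simp only: xx sum.distrib last add.assoc)
      qed
      also have "(\<Sum>\<nu><m. cnj (d \<nu>) * K i (p \<nu>)) = cnj (\<Sum>\<mu><m. d \<mu> * K (p \<mu>) i)"
        by (simp add: psd_scalar_kernel_hermitian[OF K, of i])
      finally show "0 \<le> (norm x)\<^sup>2 + 2 * s * t + s\<^sup>2 * Re (K i i)"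
        by (simp add: complex_nonneg_Reals_iff cinner_self t power2_eq_square)
    qed (rule psd_scalar_kernel_diagonal[OF K])
  qed
  then have "span B \<subseteq> {q. (snd q)\<^sup>2 \<le> Re (K i i) * (norm (fst q))\<^sup>2}"
    by auto
  then have "G \<subseteq> {q. (snd q)\<^sup>2 \<le> Re (K i i) * (norm (fst q))\<^sup>2}"
    unfolding G_def by (rule closure_minimal) (intro closed_Collect_le continuous_intros)
  then have bound: "t\<^sup>2 \<le> Re (K i i) * (norm x)\<^sup>2" if "(x, t) \<in> G" for x t
    using that by auto
  have "closed G" "subspace G"
    by (simp_all add: G_def subspace_closure)
  then obtain p where p: "p \<in> fst ` G" "\<And>x t. (x, t) \<in> G \<Longrightarrow> t = inner x p" "(norm p)\<^sup>2 \<le> Re (K i i)"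
    using bounded_graph_representer[OF _ _ bound psd_scalar_kernel_diagonal(2)[OF K]] by metis
  have "B \<subseteq> G"
    unfolding G_def using span_superset closure_subset by blast
  have "cinner (f j) p = K j i" if "j \<in> J" for j
  proof -
    have "Re (c * K j i) = Re (c * cinner (f j) p)" for c
      using p(2)[of "c *\<^sub>C f j" "Re (c * K j i)"] \<open>B \<subseteq> G\<close> that
      by (auto simp: B_def inner_Re_cinner cinner_scaleC_left)
    from this[of 1] this[of \<i>] show ?thesis
      by (simp add: complex_eq_iff)
  qed
  moreover have "p \<in> orthocomplement (orthocomplement (f ` J))"
  proof -
    have "B \<subseteq> orthocomplement (orthocomplement (f ` J)) \<times> UNIV"
      using subset_double_complement[of "f ` J"] by (auto simp: B_def intro!: orthocomplement_scaleC)
    then have "span B \<subseteq> orthocomplement (orthocomplement (f ` J)) \<times> UNIV"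
      by (rule span_minimal) (intro subspace_Times subspace_orthocomplement subspace_UNIV)
    then have "G \<subseteq> orthocomplement (orthocomplement (f ` J)) \<times> UNIV"
      unfolding G_def by (rule closure_minimal) (intro closed_Times closed_orthocomplement closed_UNIV)
    then show ?thesis
      using p(1) by auto
  qed
  ultimately show thesis
    using that p(3) by blast
qed

text \<open>
  A transfinite Cholesky factorisation. Along a well-order of the index set, \<open>h i\<close> is the
  representer of the prescribed scalar products with the earlier vectors, plus a multiple of
  \<open>e i\<close> that adjusts the norm. No later \<open>e k\<close> has been used, so the new direction is orthogonal
  to all earlier vectors.
\<close>

theorem Kolmogorov_decomposition:
  fixes K :: "'i \<Rightarrow> 'i \<Rightarrow> complex" and e :: "'i \<Rightarrow> 'h::complex_hilbert"
  assumes K: "psd_scalar_kernel K"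
    and e: "\<And>i j. cinner (e i) (e j) = (if i = j then 1 else 0)"
  obtains h :: "'i \<Rightarrow> 'h" where "\<And>i j. cinner (h i) (h j) = K i j"
proof -
  obtain W :: "('i \<times> 'i) set" where W: "well_order_on UNIV W"
    using well_order_on by blast
  define R where "R = W - Id"
  have wf: "wf R" and lin: "linear_order_on UNIV W"
    using W by (auto simp: R_def well_order_on_def)
  have total: "i = j \<or> (i, j) \<in> R \<or> (j, i) \<in> R" for i j
    using lin by (auto simp: R_def linear_order_on_def total_on_def)
  have "trans R"
    unfolding R_def
    by (rule trans_diff_Id)
      (use lin in \<open>simp_all add: linear_order_on_def partial_order_on_def preorder_on_def\<close>)
  have herm: "K i j = cnj (K j i)" for i j
    by (rule psd_scalar_kernel_hermitian[OF K])
  have irrefl: "(i, i) \<notin> R" for i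
    by (simp add: R_def)
  define P where "P f i r \<longleftrightarrow> (\<forall>j. (j, i) \<in> R \<longrightarrow> cinner (f j) r = K j i) \<and>
      cinner r r = K i i \<and> (\<forall>k. (i, k) \<in> R \<longrightarrow> cinner r (e k) = 0)" for f i and r :: 'h
  have "\<exists>h. \<forall>i. P h i (h i)"
  proof (rule dependent_wf_choice[OF wf])
    show "P f x r = P g x r" if "\<And>z. (z, x) \<in> R \<Longrightarrow> f z = g z" for f g x r
      using that by (auto simp: P_def)
    fix i and f assume prev: "P f j (f j)" if "(j, i) \<in> R" for j
    let ?J = "{j. (j, i) \<in> R}"
    have gram: "cinner (f j) (f k) = K j k" if "j \<in> ?J" "k \<in> ?J" for j k
    proof -
      have *: "cinner (f j) (f k) = K j k" if "(j, k) \<in> R" "(k, i) \<in> R" for j k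
        using prev[OF that(2)] that(1) by (simp add: P_def)
      have "j = k \<or> (j, k) \<in> R \<or> (k, j) \<in> R"
        by (rule total)
      then show ?thesis
      proof (elim disjE)
        assume "j = k"
        then show ?thesis
          using prev[of j] that(1) by (simp add: P_def)
      next
        assume "(j, k) \<in> R"
        then show ?thesis
          using * that by simp
      next
        assume "(k, j) \<in> R"
        then have "cinner (f k) (f j) = K k j"
          using * that by simp
        then show ?thesis
          using herm cinner_commute by metis
      qed
    qed
    obtain p where p: "\<And>j. j \<in> ?J \<Longrightarrow> cinner (f j) p = K j i" "(norm p)\<^sup>2 \<le> Re (K i i)"
      "p \<in> orthocomplement (orthocomplement (f ` ?J))"
      using psd_scalar_kernel_representer[OF K gram] by metis
    have e_perp: "cinner (f j) (e k) = 0" if "(j, i) \<in> R" "k = i \<or> (i, k) \<in> R" for j k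
      using prev[OF that(1)] that transD[OF \<open>trans R\<close>, of j i k] by (auto simp: P_def)
    then have "e k \<in> orthocomplement (f ` ?J)" if "k = i \<or> (i, k) \<in> R" for k
      using that cinner_0_swap by (auto simp: orthocomplement_def)
    then have pe: "cinner p (e k) = 0" "cinner (e k) p = 0" if "k = i \<or> (i, k) \<in> R" for k
      using double_complement_orthogonal[OF p(3)] that by auto
    define s where "s = sqrt (Re (K i i) - (norm p)\<^sup>2)"
    have "cinner (p + of_real s *\<^sub>C e i) (p + of_real s *\<^sub>C e i) = of_real ((norm p)\<^sup>2 + s\<^sup>2)"
      by (simp add: cinner_add_left cinner_add_right cinner_scaleC_left cinner_scaleC_right pe e
          cinner_self[of p] power2_eq_square)
    also have "\<dots> = K i i"
      using p(2) psd_scalar_kernel_diagonal(1)[OF K, of i] by (simp add: s_def)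
    finally have "P f i (p + of_real s *\<^sub>C e i)"
      using p(1) irrefl e_perp pe
      by (auto simp: P_def cinner_add_left cinner_add_right cinner_scaleC_left cinner_scaleC_right e)
    then show "\<exists>r. P f i r"
      by blast
  qed
  then obtain h where h: "\<And>i. P h i (h i)"
    by blast
  have hK: "cinner (h i) (h j) = K i j" for i j
    using total[of i j]
  proof (elim disjE)
    assume "(j, i) \<in> R"
    then have "cinner (h j) (h i) = K j i"
      using h[of i] by (simp add: P_def)
    then show ?thesis
      using herm cinner_commute by metis
  next
    assume "(i, j) \<in> R"
    then show ?thesis
      using h[of j] by (simp add: P_def)
  next
    assume "i = j"
    then show ?thesis
      using h[of i] by (simp add: P_def)
  qed
  show thesis
    by (rule that[of h]) (rule hK)
qed

lift_definition ell2_unit :: "'i \<Rightarrow> 'i ell2" is "\<lambda>i j. if j = i then 1 else 0"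
proof -
  fix i :: 'i
  have "(\<lambda>j. (cmod (if j = i then 1 else 0))\<^sup>2) summable_on {i}"
    by simp
  then show "(\<lambda>j. (cmod (if j = i then 1 else 0))\<^sup>2) summable_on UNIV"
    by (rule summable_on_cong_neutral[THEN iffD1, rotated -1]) auto
qed

lemma cinner_ell2_unit: "cinner (ell2_unit i) (ell2_unit j) = (if i = j then 1 else 0)"
proof -
  have "cinner (ell2_unit i) (ell2_unit j)
      = (\<Sum>\<^sub>\<infinity>k\<in>{i}. (if k = i then 1 else 0) * cnj (if k = j then 1 else 0))"
    unfolding cinner_ell2_def ell2_unit.rep_eq
    by (rule infsum_cong_neutral) auto
  then show ?thesis
    by auto
qed

section \<open>Complex differentiability\<close>

lemma blinfun_apply_scaleC: "blinfun_apply (c *\<^sub>C T) x = c *\<^sub>C blinfun_apply T x"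
  by (simp add: scaleC_blinfun.rep_eq)

lemma bounded_bilinear_scaleC_blinfun:
  "bounded_bilinear (scaleC :: complex \<Rightarrow> ('a::real_normed_vector \<Rightarrow>\<^sub>L 'b::complex_hilbert) \<Rightarrow> 'a \<Rightarrow>\<^sub>L 'b)"
proof
  show "(r *\<^sub>R c) *\<^sub>C T = r *\<^sub>R (c *\<^sub>C T)" for r c and T :: "'a \<Rightarrow>\<^sub>L 'b"
    by (simp add: scaleR_scaleC scaleC_scaleC scaleR_conv_of_real)
  have "norm (c *\<^sub>C T) \<le> norm c * norm T" for c and T :: "'a \<Rightarrow>\<^sub>L 'b"
  proof (rule norm_blinfun_bound)
    fix x
    have "cmod c * norm (blinfun_apply T x) \<le> cmod c * (norm T * norm x)"
      by (intro mult_left_mono norm_blinfun norm_ge_zero)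
    then show "norm (blinfun_apply (c *\<^sub>C T) x) \<le> cmod c * norm T * norm x"
      by (simp add: blinfun_apply_scaleC norm_scaleC mult.assoc)
  qed simp
  then show "\<exists>K. \<forall>c (T :: 'a \<Rightarrow>\<^sub>L 'b). norm (c *\<^sub>C T) \<le> norm c * norm T * K"
    by (intro exI[of _ 1]) simp
qed (simp_all add: scaleC_add_left scaleC_add_right scaleC_scaleR)

text \<open>
  The differentiability part of \<^const>\<open>holomorphic_op_on\<close>, stated at one point and for operators
  between different spaces, as they occur inside block matrices.
\<close>

definition complex_differentiable_at ::
  "(complex ^ 'n \<Rightarrow> 'b::{real_normed_vector, complex_vector}) \<Rightarrow> complex ^ 'n \<Rightarrow> bool" where
  "complex_differentiable_at f z \<longleftrightarrow>
     (\<exists>D. (f has_derivative D) (at z) \<and> (\<forall>c v. D (c *s v) = c *\<^sub>C D v))"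

lemma holomorphic_op_on_iff:
  "holomorphic_op_on S f \<longleftrightarrow> (\<forall>z\<in>S. clinear_blinfun (f z) \<and> complex_differentiable_at f z)"
  by (simp add: holomorphic_op_on_def complex_differentiable_at_def)

lemma complex_differentiable_const: "complex_differentiable_at (\<lambda>_. T) z"
  unfolding complex_differentiable_at_def by (intro exI[of _ "\<lambda>_. 0"]) simp

lemma complex_differentiable_diff:
  assumes "complex_differentiable_at f z" "complex_differentiable_at g z"
  shows "complex_differentiable_at (\<lambda>z. f z - g z) z"
proof -
  obtain D E where "(f has_derivative D) (at z)" "\<forall>c v. D (c *s v) = c *\<^sub>C D v"
    "(g has_derivative E) (at z)" "\<forall>c v. E (c *s v) = c *\<^sub>C E v"
    using assms by (auto simp: complex_differentiable_at_def)
  then show ?thesis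
    unfolding complex_differentiable_at_def
    by (intro exI[of _ "\<lambda>v. D v - E v"]) (simp add: has_derivative_diff scaleC_diff_right)
qed

lemma blinfun_compose_scaleC_left: "(c *\<^sub>C S) o\<^sub>L T = c *\<^sub>C (S o\<^sub>L T)"
  by (rule blinfun_eqI) (simp add: blinfun_apply_scaleC)

lemma blinfun_compose_scaleC_right:
  "clinear_blinfun S \<Longrightarrow> S o\<^sub>L (c *\<^sub>C T) = c *\<^sub>C (S o\<^sub>L T)"
  by (rule blinfun_eqI) (simp add: blinfun_apply_scaleC clinear_blinfunD)

lemma complex_differentiable_compose:
  fixes f :: "complex ^ 'n \<Rightarrow> 'b::complex_hilbert \<Rightarrow>\<^sub>L 'c::complex_hilbert"
  assumes "complex_differentiable_at f z" "complex_differentiable_at g z" "clinear_blinfun (f z)"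
  shows "complex_differentiable_at (\<lambda>z. f z o\<^sub>L g z) z"
proof -
  obtain D E where *: "(f has_derivative D) (at z)" "\<forall>c v. D (c *s v) = c *\<^sub>C D v"
    "(g has_derivative E) (at z)" "\<forall>c v. E (c *s v) = c *\<^sub>C E v"
    using assms by (auto simp: complex_differentiable_at_def)
  show ?thesis
    unfolding complex_differentiable_at_def
  proof (intro exI conjI)
    show "((\<lambda>z. f z o\<^sub>L g z) has_derivative (\<lambda>v. (f z o\<^sub>L E v) + (D v o\<^sub>L g z))) (at z)"
      by (rule bounded_bilinear.FDERIV[OF bounded_bilinear_blinfun_compose *(1) *(3)])
    show "\<forall>c v. (f z o\<^sub>L E (c *s v)) + (D (c *s v) o\<^sub>L g z) = c *\<^sub>C ((f z o\<^sub>L E v) + (D v o\<^sub>L g z))"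
      using *(2,4) assms(3)
      by (simp add: blinfun_compose_scaleC_left blinfun_compose_scaleC_right scaleC_add_right)
  qed
qed

text \<open>
  Here \<open>R w - R z + R z \<circ> d (w - z) \<circ> R z\<close> equals \<open>R w \<circ> d (w - z) \<circ> R z \<circ> d (w - z) \<circ> R z\<close>, which is of
  second order, since \<open>R w\<close> stays bounded near \<open>z\<close>.
\<close>

lemma has_derivative_inverse_operator:
  fixes d :: "'x::real_normed_vector \<Rightarrow> 'a::complex_hilbert \<Rightarrow>\<^sub>L 'a"
  assumes d: "bounded_linear d" and "open S" "z \<in> S"
    and inverse: "\<And>w. w \<in> S \<Longrightarrow> is_inverse_operator (d w) (R w)"
  shows "(R has_derivative (\<lambda>v. - (R z o\<^sub>L d v o\<^sub>L R z))) (at z)"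
  unfolding has_derivative_at_alt
proof (intro conjI allI impI)
  interpret d: bounded_linear d by fact
  show "bounded_linear (\<lambda>v. - (R z o\<^sub>L d v o\<^sub>L R z))"
    by (intro bounded_linear_minus
      bounded_linear_compose[OF bounded_bilinear.bounded_linear_left[OF bounded_bilinear_blinfun_compose]]
      bounded_linear_compose[OF bounded_bilinear.bounded_linear_right[OF bounded_bilinear_blinfun_compose] d])
  fix e :: real assume "e > 0"
  obtain M where M: "M > 0" "\<And>v. norm (d v) \<le> norm v * M"
    using d.pos_bounded by blast
  define r where "r = norm (R z) + 1"
  have r: "r > 0" "norm (R z) \<le> r"
    by (simp_all add: r_def add_nonneg_pos)
  obtain \<delta>0 where \<delta>0: "\<delta>0 > 0" "\<And>w. dist w z < \<delta>0 \<Longrightarrow> w \<in> S"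
    using \<open>open S\<close> \<open>z \<in> S\<close> by (auto simp: open_dist)
  define \<delta> where "\<delta> = min \<delta>0 (min (1 / (2 * M * r)) (e / (2 * r ^ 3 * M\<^sup>2)))"
  have "\<delta> > 0"
    using \<delta>0 M r \<open>e > 0\<close> by (simp add: \<delta>_def)
  moreover have "norm (R w - R z - - (R z o\<^sub>L d (w - z) o\<^sub>L R z)) \<le> e * norm (w - z)"
    if w: "norm (w - z) < \<delta>" for w
  proof -
    have "w \<in> S"
      using w \<delta>0 by (simp add: \<delta>_def dist_norm)
    note Rw = is_inverse_operator_apply[OF inverse[OF \<open>w \<in> S\<close>]]
    note Rz = is_inverse_operator_apply[OF inverse[OF \<open>z \<in> S\<close>]]
    have diff: "R w = R z - (R w o\<^sub>L d (w - z) o\<^sub>L R z)"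
      by (rule blinfun_eqI) (simp add: d.diff blinfun.diff_left blinfun.diff_right Rw Rz)
    have dn: "norm (d (w - z)) * r \<le> 1 / 2"
    proof -
      have "norm (w - z) \<le> 1 / (2 * M * r)"
        using w by (simp add: \<delta>_def)
      then have "norm (w - z) * M * r \<le> 1 / 2"
        using M r by (simp add: field_simps)
      then show ?thesis
        using mult_right_mono[OF M(2)[of "w - z"], of r] r by linarith
    qed
    have comp3: "norm (X o\<^sub>L Y o\<^sub>L Z) \<le> norm X * norm Y * norm Z" for X Y Z :: "'a \<Rightarrow>\<^sub>L 'a"
      by (meson mult_right_mono norm_blinfun_compose norm_ge_zero order_trans)
    have "norm (R w) \<le> norm (R z) + norm (R w) * (norm (d (w - z)) * norm (R z))"
      using norm_triangle_ineq4[of "R z" "R w o\<^sub>L d (w - z) o\<^sub>L R z"] comp3[of "R w" "d (w - z)" "R z"]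
      by (subst diff) (simp add: mult.assoc)
    also have "\<dots> \<le> r + norm (R w) * (1 / 2)"
      using r order_trans[OF mult_left_mono[OF r(2)] dn]
      by (intro add_mono mult_left_mono) auto
    finally have Rw_bound: "norm (R w) \<le> 2 * r"
      by simp
    have "R w - R z - - (R z o\<^sub>L d (w - z) o\<^sub>L R z)
        = (R w o\<^sub>L d (w - z) o\<^sub>L R z) o\<^sub>L d (w - z) o\<^sub>L R z"
      by (rule blinfun_eqI) (simp add: d.diff blinfun.diff_left blinfun.diff_right blinfun.minus_left blinfun.add_left Rw Rz)
    then have "norm (R w - R z - - (R z o\<^sub>L d (w - z) o\<^sub>L R z))
        \<le> norm (R w o\<^sub>L d (w - z) o\<^sub>L R z) * norm (d (w - z)) * norm (R z)"
      using comp3 by metis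
    also have "\<dots> \<le> ((2 * r) * (norm (w - z) * M) * r) * (norm (w - z) * M) * r"
      using r M Rw_bound
      by (intro mult_mono order_trans[OF comp3]) (auto intro!: mult_nonneg_nonneg)
    also have "\<dots> = norm (w - z) * (2 * r ^ 3 * M\<^sup>2) * norm (w - z)"
      by (simp add: power2_eq_square power3_eq_cube)
    also have "\<dots> \<le> e * norm (w - z)"
    proof (rule mult_right_mono)
      have "norm (w - z) \<le> e / (2 * r ^ 3 * M\<^sup>2)"
        using w by (simp add: \<delta>_def)
      then show "norm (w - z) * (2 * r ^ 3 * M\<^sup>2) \<le> e"
        using M r by (simp add: pos_le_divide_eq)
    qed simp
    finally show ?thesis .
  qed
  ultimately show "\<exists>\<delta>>0. \<forall>w. norm (w - z) < \<delta> \<longrightarrow>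
      norm (R w - R z - - (R z o\<^sub>L d (w - z) o\<^sub>L R z)) \<le> e * norm (w - z)"
    by blast
qed

lemma complex_differentiable_inverse:
  fixes d :: "complex ^ 'n \<Rightarrow> 'a::complex_hilbert \<Rightarrow>\<^sub>L 'a"
  assumes d: "bounded_linear d" "\<And>c v. d (c *s v) = c *\<^sub>C d v" and "open S" "z \<in> S"
    and inverse: "\<And>w. w \<in> S \<Longrightarrow> is_inverse_operator (d w) (R w)"
  shows "complex_differentiable_at R z"
  unfolding complex_differentiable_at_def
proof (intro exI conjI)
  show "(R has_derivative (\<lambda>v. - (R z o\<^sub>L d v o\<^sub>L R z))) (at z)"
    by (rule has_derivative_inverse_operator[OF d(1) \<open>open S\<close> \<open>z \<in> S\<close> inverse])
  have "clinear_blinfun (R z)"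
    using inverse[OF \<open>z \<in> S\<close>] by (simp add: is_inverse_operator_def)
  then show "\<forall>c v. - (R z o\<^sub>L d (c *s v) o\<^sub>L R z) = c *\<^sub>C - (R z o\<^sub>L d v o\<^sub>L R z)"
    by (simp add: d(2) blinfun_compose_scaleC_left blinfun_compose_scaleC_right scaleC_minus_right)
qed

section \<open>Linear pencils\<close>

lemma linear_pencil_apply:
  "blinfun_apply (linear_pencil A z) x = (\<Sum>k\<in>UNIV. (z $ k) *\<^sub>C blinfun_apply (A k) x)"
  by (simp add: linear_pencil_def blinfun.sum_left blinfun_apply_scaleC)

lemma bounded_linear_linear_pencil: "bounded_linear (linear_pencil A)"
  unfolding linear_pencil_def
  by (intro bounded_linear_sum bounded_linear_compose[OF
      bounded_bilinear.bounded_linear_left[OF bounded_bilinear_scaleC_blinfun]] bounded_linear_vec_nth)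

lemma linear_pencil_scale: "linear_pencil A (c *s z) = c *\<^sub>C linear_pencil A z"
  by (simp add: linear_pencil_def scaleC_sum_right scaleC_scaleC)

lemma clinear_linear_pencil:
  "(\<And>k. clinear_blinfun (A k)) \<Longrightarrow> clinear_blinfun (linear_pencil A z)"
  by (simp add: clinear_blinfun_def linear_pencil_apply scaleC_sum_right scaleC_scaleC mult.commute)

lemma complex_differentiable_linear_pencil: "complex_differentiable_at (linear_pencil A) z"
  unfolding complex_differentiable_at_def
  using bounded_linear_imp_has_derivative[OF bounded_linear_linear_pencil] linear_pencil_scale by blast

lemma blinfun_apply_inl_inr [simp]:
  "blinfun_apply inl_blinfun u = (u, 0)" "blinfun_apply inr_blinfun h = (0, h)"
  by (simp_all add: inl_blinfun.rep_eq inr_blinfun.rep_eq)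

lemma clinear_block_maps:
  "clinear_blinfun (fst_blinfun :: ('u::complex_hilbert \<times> 'h::complex_hilbert) \<Rightarrow>\<^sub>L 'u)"
  "clinear_blinfun (snd_blinfun :: ('u \<times> 'h) \<Rightarrow>\<^sub>L 'h)"
  "clinear_blinfun (inl_blinfun :: 'u \<Rightarrow>\<^sub>L ('u \<times> 'h))"
  "clinear_blinfun (inr_blinfun :: 'h \<Rightarrow>\<^sub>L ('u \<times> 'h))"
  by (simp_all add: clinear_blinfun_def scaleC_prod_def)

lemma clinear_compose:
  "clinear_blinfun S \<Longrightarrow> clinear_blinfun T \<Longrightarrow> clinear_blinfun (S o\<^sub>L T)"
  by (simp add: clinear_blinfun_def)

lemma clinear_diff:
  "clinear_blinfun S \<Longrightarrow> clinear_blinfun T \<Longrightarrow> clinear_blinfun (S - T)"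
  by (simp add: clinear_blinfun_def blinfun.diff_left scaleC_diff_right)

lemma block_apply:
  "blinfun_apply (block_a T) u = fst (blinfun_apply T (u, 0))"
  "blinfun_apply (block_b T) h = fst (blinfun_apply T (0, h))"
  "blinfun_apply (block_c T) u = snd (blinfun_apply T (u, 0))"
  "blinfun_apply (block_d T) h = snd (blinfun_apply T (0, h))"
  by (simp_all add: block_a_def block_b_def block_c_def block_d_def)

lemma clinear_blocks:
  assumes "clinear_blinfun T"
  shows "clinear_blinfun (block_a T)" "clinear_blinfun (block_b T)"
    "clinear_blinfun (block_c T)" "clinear_blinfun (block_d T)"
  unfolding block_a_def block_b_def block_c_def block_d_def
  by (intro clinear_compose clinear_block_maps assms)+

lemma block_d_linear:
  "bounded_linear (block_d :: _ \<Rightarrow> 'h::complex_hilbert \<Rightarrow>\<^sub>L 'h)"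
  unfolding block_d_def
  by (intro bounded_linear_compose[OF bounded_bilinear.bounded_linear_left[OF bounded_bilinear_blinfun_compose]]
      bounded_bilinear.bounded_linear_right[OF bounded_bilinear_blinfun_compose])

lemma block_d_scaleC: "block_d (c *\<^sub>C T) = c *\<^sub>C block_d T"
  by (rule blinfun_eqI) (simp add: block_apply blinfun_apply_scaleC scaleC_prod_def)

lemma complex_differentiable_blocks:
  fixes T :: "complex ^ 'n \<Rightarrow> ('u::complex_hilbert \<times> 'h::complex_hilbert) \<Rightarrow>\<^sub>L ('u \<times> 'h)"
  assumes "complex_differentiable_at T z" "clinear_blinfun (T z)"
  shows "complex_differentiable_at (\<lambda>z. block_a (T z)) z"
    "complex_differentiable_at (\<lambda>z. block_b (T z)) z"
    "complex_differentiable_at (\<lambda>z. block_c (T z)) z"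
  unfolding block_a_def block_b_def block_c_def
  by (intro complex_differentiable_compose complex_differentiable_const assms
      clinear_compose clinear_block_maps)+

section \<open>The domain Omega\<close>

lemma mem_half_plane_power: "z \<in> half_plane_power \<longleftrightarrow> (\<forall>k. Re (z $ k) > 0)"
  by (simp add: half_plane_power_def right_half_plane_def)

text \<open>
  The rotation is moved from the half-plane to the point. The inequalities are then open conditions on \<open>z\<close>
  and adapt to scaling.
\<close>

lemma mem_Omega:
  "z \<in> Omega \<longleftrightarrow> (\<exists>l. cmod l = 1 \<and> (\<forall>k. Re (l * z $ k) > 0))"
proof
  assume "z \<in> Omega"
  then obtain l w where *: "cmod l = 1" "w \<in> half_plane_power" "z = l *s w"
    by (rule Omega_obtain)
  have "cnj l * l = 1"
    using *(1) complex_norm_square[of l] by (simp add: mult.commute)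
  with * show "\<exists>l. cmod l = 1 \<and> (\<forall>k. Re (l * z $ k) > 0)"
    by (intro exI[of _ "cnj l"]) (simp add: mem_half_plane_power mult.assoc[symmetric] del: times_complex.sel)
next
  assume "\<exists>l. cmod l = 1 \<and> (\<forall>k. Re (l * z $ k) > 0)"
  then obtain l where l: "cmod l = 1" "\<forall>k. Re (l * z $ k) > 0"
    by blast
  have "cnj l * l = 1"
    using l(1) complex_norm_square[of l] by (simp add: mult.commute)
  then have "z $ k = cnj l * (l * z $ k)" for k
    by (simp add: mult.assoc[symmetric])
  then have "z $ k \<in> (\<lambda>w. cnj l * w) ` right_half_plane" for k
    by (rule image_eqI) (use l in \<open>simp add: right_half_plane_def\<close>)
  then show "z \<in> Omega"
    using l(1) unfolding Omega_def by (intro UN_I[of "cnj l"]) simp_all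
qed

lemma open_half_plane_power: "open (half_plane_power :: (complex ^ 'n::finite) set)"
proof -
  have "half_plane_power = (\<Inter>k. {z :: complex ^ 'n. Re (z $ k) > 0})"
    by (auto simp: mem_half_plane_power)
  also have "open \<dots>"
    by (intro open_INT ballI open_Collect_less continuous_intros) simp
  finally show ?thesis .
qed

lemma open_Omega: "open (Omega :: (complex ^ 'n::finite) set)"
proof -
  have "Omega = (\<Union>l\<in>{l. cmod l = 1}. \<Inter>k. {z :: complex ^ 'n. Re (l * z $ k) > 0})"
    by (auto simp: mem_Omega)
  also have "open \<dots>"
    by (intro open_UN open_INT ballI open_Collect_less continuous_intros) simp
  finally show ?thesis .
qed

lemma Omega_scale:
  assumes "z \<in> Omega" "c \<noteq> 0"
  shows "c *s z \<in> Omega"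
proof -
  obtain l where l: "cmod l = 1" "\<And>k. Re (l * z $ k) > 0"
    using assms by (auto simp: mem_Omega simp del: times_complex.sel)
  define m where "m = l * cnj c / of_real (cmod c)"
  have "cnj c * c = of_real (cmod c) * of_real (cmod c)"
    using complex_norm_square[of c] by (simp add: power2_eq_square mult.commute)
  then have "m * (c *s z) $ k = of_real (cmod c) * (l * z $ k)" for k
    using assms(2) by (simp add: m_def field_simps)
  then have "Re (m * (c *s z) $ k) = cmod c * Re (l * z $ k)" for k
    by (simp only: Re_complex_of_real Im_complex_of_real times_complex.sel(1)[of "of_real (cmod c)"])
  moreover have "cmod m = 1"
    using l(1) assms(2) by (simp add: m_def norm_mult norm_divide)
  ultimately show ?thesis
    using l(2) assms(2) unfolding mem_Omega by (intro exI[of _ m]) simp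
qed

definition cnj_vec :: "complex ^ 'n \<Rightarrow> complex ^ 'n" where
  "cnj_vec z = (\<chi> k. cnj (z $ k))"

lemma cnj_vec_nth [simp]: "cnj_vec z $ k = cnj (z $ k)"
  by (simp add: cnj_vec_def)

lemma cnj_vec_scale: "cnj_vec (c *s z) = cnj c *s cnj_vec z"
  by (simp add: vec_eq_iff)

lemma bounded_linear_cnj_vec: "bounded_linear (cnj_vec :: complex ^ 'n::finite \<Rightarrow> complex ^ 'n)"
  by (rule linear_conv_bounded_linear[THEN iffD1], rule linearI) (simp_all add: vec_eq_iff)

lemma Omega_cnj_vec: "z \<in> Omega \<Longrightarrow> cnj_vec z \<in> Omega"
  unfolding mem_Omega by (metis cnj_vec_nth complex_cnj_mult complex_mod_cnj cnj.sel(1))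

section \<open>Kernels of a long resolvent representation\<close>

text \<open>
  The column \<open>solution z = (1, - d(z)\<inverse> c(z))\<close> solves \<open>A(z) (u, h) = (f(z) u, 0)\<close> for the value
  \<open>f = transfer\<close>, and \<open>cosolution z = (1, - b(z) d(z)\<inverse>)\<close> is the corresponding row. As a function of \<open>z\<close>
  the row is holomorphic; the adjoint of the column at \<open>\<zeta>\<close> is the row at the conjugate of \<open>\<zeta>\<close>. This
  is why the kernels are written with \<open>cosolution (cnj_vec \<zeta>)\<close>.
\<close>

locale invertible_pencil =
  fixes A :: "'n::finite \<Rightarrow> ('u::complex_hilbert \<times> 'h::complex_hilbert) \<Rightarrow>\<^sub>L ('u \<times> 'h)"
  assumes psd: "psd_operator (A k)"
    and invertible: "z \<in> Omega \<Longrightarrow> \<exists>R. is_inverse_operator (block_d (linear_pencil A z)) R"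
begin

definition resolvent :: "complex ^ 'n \<Rightarrow> 'h \<Rightarrow>\<^sub>L 'h" where
  "resolvent z = (SOME R. is_inverse_operator (block_d (linear_pencil A z)) R)"

definition solution :: "complex ^ 'n \<Rightarrow> 'u \<Rightarrow>\<^sub>L ('u \<times> 'h)" where
  "solution z = inl_blinfun - (inr_blinfun o\<^sub>L resolvent z o\<^sub>L block_c (linear_pencil A z))"

definition cosolution :: "complex ^ 'n \<Rightarrow> ('u \<times> 'h) \<Rightarrow>\<^sub>L 'u" where
  "cosolution z = fst_blinfun - (block_b (linear_pencil A z) o\<^sub>L resolvent z o\<^sub>L snd_blinfun)"

definition transfer :: "complex ^ 'n \<Rightarrow> 'u \<Rightarrow>\<^sub>L 'u" where
  "transfer z = block_a (linear_pencil A z)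
     - (block_b (linear_pencil A z) o\<^sub>L resolvent z o\<^sub>L block_c (linear_pencil A z))"

definition kernel :: "'n \<Rightarrow> complex ^ 'n \<Rightarrow> complex ^ 'n \<Rightarrow> 'u \<Rightarrow>\<^sub>L 'u" where
  "kernel k z \<zeta> = cosolution (cnj_vec \<zeta>) o\<^sub>L A k o\<^sub>L solution z"

end

lemma (in invertible_pencil) resolvent_inverse:
  "z \<in> Omega \<Longrightarrow> is_inverse_operator (block_d (linear_pencil A z)) (resolvent z)"
  unfolding resolvent_def by (rule someI_ex) (rule invertible)

lemma (in invertible_pencil) resolvent_eqI:
  "z \<in> Omega \<Longrightarrow> is_inverse_operator (block_d (linear_pencil A z)) R \<Longrightarrow> resolvent z = R"
  using resolvent_inverse is_inverse_operator_unique by blast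

lemma (in invertible_pencil) clinear_A: "clinear_blinfun (A k)"
  using psd by (simp add: psd_operator_def)

lemma (in invertible_pencil) clinear_pencil: "clinear_blinfun (linear_pencil A z)"
  by (rule clinear_linear_pencil) (rule clinear_A)

lemma (in invertible_pencil) clinear_resolvent: "z \<in> Omega \<Longrightarrow> clinear_blinfun (resolvent z)"
  using resolvent_inverse by (auto simp: is_inverse_operator_def)

lemma (in invertible_pencil) clinear_solution:
  assumes "z \<in> Omega"
  shows "clinear_blinfun (solution z)" "clinear_blinfun (cosolution z)" "clinear_blinfun (transfer z)"
  unfolding solution_def cosolution_def transfer_def
  by (intro clinear_diff clinear_compose clinear_block_maps clinear_blocks clinear_resolvent
      clinear_pencil assms)+

lemma (in invertible_pencil) solution_apply:
  "blinfun_apply (solution z) u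
    = (u, - blinfun_apply (resolvent z) (snd (blinfun_apply (linear_pencil A z) (u, 0))))"
  by (simp add: solution_def blinfun.diff_left block_apply)

lemma (in invertible_pencil) cosolution_apply:
  "blinfun_apply (cosolution z) (u, h)
    = u - fst (blinfun_apply (linear_pencil A z) (0, blinfun_apply (resolvent z) h))"
  by (simp add: cosolution_def blinfun.diff_left block_apply)

lemma blinfun_apply_pair_split:
  "blinfun_apply T (u, h) = blinfun_apply T (u, 0) + blinfun_apply T (0, h)"
  using blinfun.add_right[of T "(u, 0)" "(0, h)"] by simp

lemma blinfun_apply_pair_minus:
  "blinfun_apply T (0, - h) = - blinfun_apply T (0, h)"
  using blinfun.minus_right[of T "(0, h)"] by simp

lemma (in invertible_pencil) pencil_solution:
  assumes "z \<in> Omega"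
  shows "blinfun_apply (linear_pencil A z) (blinfun_apply (solution z) u) = (blinfun_apply (transfer z) u, 0)"
proof -
  let ?T = "linear_pencil A z"
  let ?h = "blinfun_apply (resolvent z) (snd (blinfun_apply ?T (u, 0)))"
  have "snd (blinfun_apply ?T (0, ?h)) = snd (blinfun_apply ?T (u, 0))"
    using is_inverse_operator_apply(1)[OF resolvent_inverse[OF assms]] by (simp add: block_apply)
  moreover have "fst (blinfun_apply ?T (u, 0)) - fst (blinfun_apply ?T (0, ?h)) = blinfun_apply (transfer z) u"
    by (simp add: transfer_def blinfun.diff_left block_apply)
  moreover have "blinfun_apply ?T (blinfun_apply (solution z) u)
      = blinfun_apply ?T (u, 0) - blinfun_apply ?T (0, ?h)"
    unfolding solution_apply by (subst blinfun_apply_pair_split) (simp add: blinfun_apply_pair_minus)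
  ultimately show ?thesis
    by (simp add: prod_eq_iff)
qed

text \<open>
  Since \<open>d(z)\<close> is invertible, the second row of the system determines \<open>h\<close>. Hence any explicit
  solution identifies both the column \<open>solution z\<close> and the value \<open>transfer z\<close>.
\<close>

lemma (in invertible_pencil) solution_unique:
  assumes "z \<in> Omega" "blinfun_apply (linear_pencil A z) (u, h) = (v, 0)"
  shows "blinfun_apply (solution z) u = (u, h)" "blinfun_apply (transfer z) u = v"
proof -
  let ?T = "linear_pencil A z"
  let ?R = "blinfun_apply (resolvent z)"
  have "snd (blinfun_apply ?T (0, h)) = - snd (blinfun_apply ?T (u, 0))"
    using assms(2) by (subst (asm) blinfun_apply_pair_split)
      (simp add: prod_eq_iff eq_neg_iff_add_eq_0 add.commute)
  then have "?R (blinfun_apply (block_d ?T) h) = ?R (- snd (blinfun_apply ?T (u, 0)))"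
    by (simp add: block_apply)
  then have "h = - ?R (snd (blinfun_apply ?T (u, 0)))"
    using is_inverse_operator_apply(2)[OF resolvent_inverse[OF assms(1)]] by (simp add: blinfun.minus_right)
  then show "blinfun_apply (solution z) u = (u, h)"
    by (simp add: solution_apply)
  then show "blinfun_apply (transfer z) u = v"
    using pencil_solution[OF assms(1), of u] assms(2) by simp
qed

lemma (in invertible_pencil) adjoint_pencil:
  "cinner (blinfun_apply (linear_pencil A z) x) y = cinner x (blinfun_apply (linear_pencil A (cnj_vec z)) y)"
proof -
  have "cinner (blinfun_apply (A k) x) y = cinner x (blinfun_apply (A k) y)" for k
    by (rule is_adjointD) (use psd in \<open>simp add: psd_operator_def\<close>)
  then show ?thesis
    by (simp add: linear_pencil_apply cinner_sum_left cinner_sum_right cinner_scaleC_left cinner_scaleC_right)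
qed

text \<open>
  The adjoint of \<open>solution \<zeta>\<close> is \<open>cosolution\<close> at the conjugate point, because the adjoint of a
  pencil with self-adjoint coefficients is the pencil there.
\<close>

lemma (in invertible_pencil) adjoint_solution:
  assumes "\<zeta> \<in> Omega"
  shows "is_adjoint (solution \<zeta>) (cosolution (cnj_vec \<zeta>))"
  unfolding is_adjoint_def
proof (intro allI)
  fix u and y :: "'u \<times> 'h"
  obtain v h where y: "y = (v, h)"
    by force
  let ?T = "linear_pencil A \<zeta>" and ?T' = "linear_pencil A (cnj_vec \<zeta>)"
  let ?p = "blinfun_apply (resolvent \<zeta>) (snd (blinfun_apply ?T (u, 0)))"
  let ?q = "blinfun_apply (resolvent (cnj_vec \<zeta>)) h"
  have "snd (blinfun_apply ?T (0, ?p)) = snd (blinfun_apply ?T (u, 0))"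
    using is_inverse_operator_apply(1)[OF resolvent_inverse[OF assms]] by (simp add: block_apply)
  moreover have "snd (blinfun_apply ?T' (0, ?q)) = h"
    using is_inverse_operator_apply(1)[OF resolvent_inverse[OF Omega_cnj_vec[OF assms]]] by (simp add: block_apply)
  moreover have "cinner (blinfun_apply ?T (0, ?p)) (0, ?q) = cinner (0, ?p) (blinfun_apply ?T' (0, ?q))"
    "cinner (blinfun_apply ?T (u, 0)) (0, ?q) = cinner (u, 0) (blinfun_apply ?T' (0, ?q))"
    by (rule adjoint_pencil)+
  ultimately have "cinner ?p h = cinner u (fst (blinfun_apply ?T' (0, ?q)))"
    by (simp add: cinner_prod_def)
  then show "cinner (blinfun_apply (solution \<zeta>) u) y = cinner u (blinfun_apply (cosolution (cnj_vec \<zeta>)) y)"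
    unfolding y solution_apply cosolution_apply
    by (simp add: cinner_prod_def cinner_diff_right bounded_bilinear.minus_left[OF bounded_bilinear_cinner])
qed

text \<open>
  The kernel is thus the Gram kernel of the solutions with respect to the form of \<open>A k\<close>; positivity
  and the symmetry in the two variables come from here.
\<close>

lemma (in invertible_pencil) cinner_kernel:
  assumes "\<zeta> \<in> Omega"
  shows "cinner (blinfun_apply (kernel k z \<zeta>) u) v
    = cinner (blinfun_apply (A k) (blinfun_apply (solution z) u)) (blinfun_apply (solution \<zeta>) v)"
  by (simp add: kernel_def is_adjointD'[OF adjoint_solution[OF assms]])

lemma (in invertible_pencil) complex_differentiable_resolvent:
  assumes "z \<in> Omega"
  shows "complex_differentiable_at resolvent z"
proof (rule complex_differentiable_inverse)
  show "bounded_linear (\<lambda>z. block_d (linear_pencil A z))"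
    by (rule bounded_linear_compose[OF block_d_linear bounded_linear_linear_pencil])
  show "block_d (linear_pencil A (c *s v)) = c *\<^sub>C block_d (linear_pencil A v)" for c v
    by (simp add: linear_pencil_scale block_d_scaleC)
qed (use assms resolvent_inverse open_Omega in auto)

lemma (in invertible_pencil) complex_differentiable_solution:
  assumes "z \<in> Omega"
  shows "complex_differentiable_at solution z" "complex_differentiable_at cosolution z"
    "complex_differentiable_at transfer z"
proof -
  note blocks = complex_differentiable_blocks[OF complex_differentiable_linear_pencil clinear_pencil]
  note intros = complex_differentiable_diff complex_differentiable_compose complex_differentiable_const
    complex_differentiable_resolvent blocks assms clinear_compose clinear_block_maps
    clinear_blocks clinear_resolvent clinear_pencil
  have "complex_differentiable_at (\<lambda>z. inl_blinfun - (inr_blinfun o\<^sub>L resolvent z o\<^sub>L block_c (linear_pencil A z))) z"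
    by (intro intros)
  then show "complex_differentiable_at solution z"
    by (simp add: solution_def[abs_def])
  have "complex_differentiable_at (\<lambda>z. fst_blinfun - (block_b (linear_pencil A z) o\<^sub>L resolvent z o\<^sub>L snd_blinfun)) z"
    by (intro intros)
  then show "complex_differentiable_at cosolution z"
    by (simp add: cosolution_def[abs_def])
  have "complex_differentiable_at (\<lambda>z. block_a (linear_pencil A z)
     - (block_b (linear_pencil A z) o\<^sub>L resolvent z o\<^sub>L block_c (linear_pencil A z))) z"
    by (intro intros)
  then show "complex_differentiable_at transfer z"
    by (simp add: transfer_def[abs_def])
qed

lemma (in invertible_pencil) holomorphic_transfer: "holomorphic_op_on Omega transfer"
  by (simp add: holomorphic_op_on_iff clinear_solution complex_differentiable_solution)

lemma antiholomorphic_op_on_cnj_vec: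
  fixes f :: "complex ^ 'n::finite \<Rightarrow> 'u::complex_hilbert \<Rightarrow>\<^sub>L 'u"
  assumes "\<And>\<zeta>. \<zeta> \<in> S \<Longrightarrow> clinear_blinfun (f (cnj_vec \<zeta>)) \<and> complex_differentiable_at f (cnj_vec \<zeta>)"
  shows "antiholomorphic_op_on S (\<lambda>\<zeta>. f (cnj_vec \<zeta>))"
  unfolding antiholomorphic_op_on_def
proof
  fix \<zeta> assume "\<zeta> \<in> S"
  then obtain D where D: "(f has_derivative D) (at (cnj_vec \<zeta>))" "\<forall>c v. D (c *s v) = c *\<^sub>C D v"
    using assms[of \<zeta>] unfolding complex_differentiable_at_def by blast
  have "((\<lambda>\<zeta>. f (cnj_vec \<zeta>)) has_derivative (\<lambda>v. D (cnj_vec v))) (at \<zeta>)"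
    using has_derivative_compose[OF bounded_linear_imp_has_derivative[OF bounded_linear_cnj_vec] D(1)] .
  moreover have "\<forall>c v. D (cnj_vec (c *s v)) = cnj c *\<^sub>C D (cnj_vec v)"
    by (simp add: cnj_vec_scale D(2))
  ultimately show "clinear_blinfun (f (cnj_vec \<zeta>)) \<and>
      (\<exists>D. ((\<lambda>\<zeta>. f (cnj_vec \<zeta>)) has_derivative D) (at \<zeta>) \<and> (\<forall>c v. D (c *s v) = cnj c *\<^sub>C D v))"
    using assms[OF \<open>\<zeta> \<in> S\<close>] by blast
qed

lemma (in invertible_pencil) holomorphic_psd_kernel_kernel:
  "holomorphic_psd_kernel Omega (kernel k)"
  unfolding holomorphic_psd_kernel_def
proof (intro conjI ballI allI impI)
  note intros = complex_differentiable_compose complex_differentiable_const clinear_A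
    clinear_compose Omega_cnj_vec clinear_solution complex_differentiable_solution
  fix z :: "complex ^ 'n" assume z: "z \<in> Omega"
  show "holomorphic_op_on Omega (\<lambda>w. kernel k w z)"
    unfolding holomorphic_op_on_iff kernel_def
    using z by (intro ballI conjI intros)
  show "antiholomorphic_op_on Omega (\<lambda>\<zeta>. kernel k z \<zeta>)"
    unfolding kernel_def
    using z by (intro antiholomorphic_op_on_cnj_vec[where f = "\<lambda>w. cosolution w o\<^sub>L A k o\<^sub>L solution z"] conjI intros)
  fix \<zeta> :: "complex ^ 'n" assume \<zeta>: "\<zeta> \<in> Omega"
  have "cinner (blinfun_apply (kernel k \<zeta> z) x) y = cinner x (blinfun_apply (kernel k z \<zeta>) y)" for x y
  proof -
    have "cinner (blinfun_apply (kernel k z \<zeta>) y) x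
        = cinner (blinfun_apply (solution z) y) (blinfun_apply (A k) (blinfun_apply (solution \<zeta>) x))"
      unfolding cinner_kernel[OF \<zeta>] by (rule is_adjointD) (use psd in \<open>simp add: psd_operator_def\<close>)
    then show ?thesis
      unfolding cinner_kernel[OF z] by (rule cinner_eq_swap[symmetric])
  qed
  then show "is_adjoint (kernel k \<zeta> z) (kernel k z \<zeta>)"
    by (simp add: is_adjoint_def)
next
  fix m :: nat and p :: "nat \<Rightarrow> complex ^ 'n" and u :: "nat \<Rightarrow> 'u"
  assume p: "\<forall>\<mu><m. p \<mu> \<in> Omega"
  let ?x = "\<Sum>\<mu><m. blinfun_apply (solution (p \<mu>)) (u \<mu>)"
  have "(\<Sum>\<mu><m. \<Sum>\<nu><m. cinner (blinfun_apply (kernel k (p \<mu>) (p \<nu>)) (u \<mu>)) (u \<nu>))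
      = (\<Sum>\<mu><m. \<Sum>\<nu><m. cinner (blinfun_apply (A k) (blinfun_apply (solution (p \<mu>)) (u \<mu>)))
          (blinfun_apply (solution (p \<nu>)) (u \<nu>)))"
    using p by (intro sum.cong refl cinner_kernel) auto
  also have "\<dots> = cinner (blinfun_apply (A k) ?x) ?x"
    by (simp only: blinfun.sum_right cinner_sum_left) (simp only: cinner_sum_right)
  also have "\<dots> \<in> \<real>\<^sub>\<ge>\<^sub>0"
    using psd[of k] unfolding psd_operator_def by blast
  finally show "(\<Sum>\<mu><m. \<Sum>\<nu><m. cinner (blinfun_apply (kernel k (p \<mu>) (p \<nu>)) (u \<mu>)) (u \<nu>)) \<in> \<real>\<^sub>\<ge>\<^sub>0" .
qed

text \<open>
  Summing over \<open>k\<close> gives \<open>cosolution\<close> applied to \<open>A(z) (solution z u) = (f(z) u, 0)\<close>. The second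
  component vanishes, so the point \<open>\<zeta>\<close> drops out.
\<close>

lemma (in invertible_pencil) kernel_identity: "kernel_identity_on Omega transfer kernel"
  unfolding kernel_identity_on_def
proof (intro ballI blinfun_eqI)
  fix z \<zeta> :: "complex ^ 'n" and u assume z: "z \<in> Omega" and \<zeta>: "\<zeta> \<in> Omega"
  note lin = clinear_blinfunD[OF clinear_solution(2)[OF Omega_cnj_vec[OF \<zeta>]]]
  have "blinfun_apply (\<Sum>k\<in>UNIV. (z $ k) *\<^sub>C kernel k z \<zeta>) u
      = blinfun_apply (cosolution (cnj_vec \<zeta>)) (blinfun_apply (linear_pencil A z) (blinfun_apply (solution z) u))"
    by (simp add: kernel_def linear_pencil_apply blinfun.sum_left blinfun.sum_right blinfun_apply_scaleC lin)
  also have "\<dots> = blinfun_apply (transfer z) u"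
    unfolding pencil_solution[OF z] cosolution_apply by (simp flip: zero_prod_def)
  finally show "blinfun_apply (transfer z) u = blinfun_apply (\<Sum>k\<in>UNIV. (z $ k) *\<^sub>C kernel k z \<zeta>) u" ..
qed

lemma (in invertible_pencil) resolvent_scale:
  assumes "z \<in> Omega" "c \<noteq> 0"
  shows "resolvent (c *s z) = inverse c *\<^sub>C resolvent z"
proof (rule resolvent_eqI[OF Omega_scale[OF assms]])
  note R = resolvent_inverse[OF assms(1)]
  show "is_inverse_operator (block_d (linear_pencil A (c *s z))) (inverse c *\<^sub>C resolvent z)"
  proof (rule is_inverse_operatorI)
    show "clinear_blinfun (inverse c *\<^sub>C resolvent z)"
      using clinear_resolvent[OF assms(1)]
      by (simp add: clinear_blinfun_def blinfun_apply_scaleC scaleC_scaleC mult.commute)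
  qed (use assms(2) in \<open>simp_all add: linear_pencil_scale block_d_scaleC blinfun_apply_scaleC
      clinear_blinfunD[OF clinear_resolvent[OF assms(1)]]
      clinear_blinfunD[OF clinear_blocks(4)[OF clinear_pencil]]
      scaleC_scaleC scaleC_one is_inverse_operator_apply[OF R]\<close>)
qed

lemma (in invertible_pencil) solution_scale:
  assumes "z \<in> Omega" "c \<noteq> 0"
  shows "solution (c *s z) = solution z" "cosolution (c *s z) = cosolution z"
proof -
  note lin = clinear_blinfunD[OF clinear_resolvent[OF assms(1)]]
  show "solution (c *s z) = solution z"
    using assms by (intro blinfun_eqI) (simp add: solution_apply resolvent_scale linear_pencil_scale
        blinfun_apply_scaleC scaleC_prod_def lin scaleC_scaleC scaleC_one)
  have "blinfun_apply (linear_pencil A z) (0, c *\<^sub>C h) = c *\<^sub>C blinfun_apply (linear_pencil A z) (0, h)" for c h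
    using clinear_blinfunD[OF clinear_pencil, of z c "(0, h)"] by (simp add: scaleC_prod_def)
  then show "cosolution (c *s z) = cosolution z"
    using assms by (intro blinfun_eqI) (auto simp: cosolution_apply resolvent_scale linear_pencil_scale
        blinfun_apply_scaleC scaleC_prod_def scaleC_scaleC scaleC_one split_paired_all)
qed

lemma (in invertible_pencil) transfer_scale:
  assumes "z \<in> Omega" "c \<noteq> 0"
  shows "transfer (c *s z) = c *\<^sub>C transfer z"
proof (rule blinfun_eqI)
  fix u
  have "blinfun_apply (linear_pencil A (c *s z)) (blinfun_apply (solution (c *s z)) u)
      = c *\<^sub>C blinfun_apply (linear_pencil A z) (blinfun_apply (solution z) u)"
    by (simp add: solution_scale[OF assms] linear_pencil_scale blinfun_apply_scaleC)
  then show "blinfun_apply (transfer (c *s z)) u = blinfun_apply (c *\<^sub>C transfer z) u"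
    by (simp add: pencil_solution assms Omega_scale scaleC_prod_def blinfun_apply_scaleC)
qed

lemma (in invertible_pencil) kernel_scale:
  assumes "z \<in> Omega" "\<zeta> \<in> Omega" "c \<noteq> 0"
  shows "kernel k (c *s z) (c *s \<zeta>) = kernel k z \<zeta>"
  using assms by (simp add: kernel_def solution_scale cnj_vec_scale Omega_cnj_vec)

lemma (in invertible_pencil) long_resolvent_representation_transfer:
  "long_resolvent_representation A transfer"
  unfolding long_resolvent_representation_def transfer_def using psd resolvent_inverse by blast

section \<open>The identity theorem on Omega\<close>

text \<open>
  A point of \<open>Omega\<close> is \<open>l *s w\<close> with \<open>w\<close> in the product of half-planes. The function of one
  variable \<open>t \<mapsto> f (t *s w)\<close> is holomorphic on the connected punctured plane, and near \<open>t = 1\<close>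
  its argument lies in the product of half-planes.
\<close>

lemma holomorphic_op_on_Omega_eqI:
  fixes f g :: "complex ^ 'n::finite \<Rightarrow> 'u::complex_hilbert \<Rightarrow>\<^sub>L 'u"
  assumes f: "holomorphic_op_on Omega f" and g: "holomorphic_op_on Omega g"
    and eq: "\<And>z. z \<in> half_plane_power \<Longrightarrow> f z = g z" and z: "z \<in> Omega"
  shows "f z = g z"
proof -
  obtain l w where lw: "cmod l = 1" "w \<in> half_plane_power" "z = l *s w"
    using Omega_obtain[OF z] by blast
  have w: "w \<in> Omega"
    using lw(2) half_plane_power_subset_Omega by blast
  have bl: "bounded_linear (\<lambda>t::complex. t *s w)"
    by (rule linear_conv_bounded_linear[THEN iffD1], rule linearI) (simp_all add: vec_eq_iff algebra_simps)
  have hol: "(\<lambda>t. cinner (blinfun_apply (h (t *s w)) u) v) holomorphic_on - {0}"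
    if h: "holomorphic_op_on Omega h" for h and u v :: 'u
    unfolding holomorphic_on_def
  proof
    fix t :: complex assume "t \<in> - {0}"
    then have "t *s w \<in> Omega"
      by (intro Omega_scale w) auto
    then obtain D where D: "(h has_derivative D) (at (t *s w))" "\<forall>c v. D (c *s v) = c *\<^sub>C D v"
      using h by (auto simp: holomorphic_op_on_def)
    have "((\<lambda>t. h (t *s w)) has_derivative (\<lambda>s. D (s *s w))) (at t)"
      using has_derivative_compose[OF bounded_linear_imp_has_derivative[OF bl] D(1)] .
    then have "((\<lambda>t. cinner (blinfun_apply (h (t *s w)) u) v)
        has_derivative (\<lambda>s. cinner (blinfun_apply (D (s *s w)) u) v)) (at t)"
      by (intro bounded_linear.has_derivative[OF bounded_bilinear.bounded_linear_left[OF bounded_bilinear_cinner]]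
          bounded_linear.has_derivative[OF blinfun.bounded_linear_left])
    moreover have "(\<lambda>s. cinner (blinfun_apply (D (s *s w)) u) v) = (*) (cinner (blinfun_apply (D w) u) v)"
      by (simp add: D(2) blinfun_apply_scaleC cinner_scaleC_left fun_eq_iff)
    ultimately have "((\<lambda>t. cinner (blinfun_apply (h (t *s w)) u) v)
        has_field_derivative cinner (blinfun_apply (D w) u) v) (at t)"
      by (simp add: has_field_derivative_def)
    then show "(\<lambda>t. cinner (blinfun_apply (h (t *s w)) u) v) field_differentiable (at t within - {0})"
      using field_differentiable_def field_differentiable_at_within by blast
  qed
  have "cinner (blinfun_apply (f (l *s w)) u) v = cinner (blinfun_apply (g (l *s w)) u) v" for u v
  proof (rule analytic_continuation_open[where z = l
        and f = "\<lambda>t. cinner (blinfun_apply (f (t *s w)) u) v"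
        and g = "\<lambda>t. cinner (blinfun_apply (g (t *s w)) u) v"
        and s = "{t. t *s w \<in> half_plane_power} \<inter> - {0}" and s' = "- {0}"])
    have "open ((\<lambda>t::complex. t *s w) -` half_plane_power)"
      using bl by (intro open_vimage open_half_plane_power linear_continuous_on)
    then show "open ({t. t *s w \<in> half_plane_power} \<inter> - {0})"
      by (auto simp: vimage_def)
    show "{t. t *s w \<in> half_plane_power} \<inter> - {0} \<noteq> {}"
    proof -
      have "1 \<in> {t. t *s w \<in> half_plane_power} \<inter> - {0}"
        using lw(2) by simp
      then show ?thesis
        by blast
    qed
    show "connected (- {0::complex})"
      by (rule connected_punctured_universe) simp
    show "l \<in> - {0}"
      using lw(1) by auto
  qed (auto simp: eq intro!: hol f g)
  then show ?thesis
    unfolding lw(3) by (intro blinfun_eqI cinner_ext)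
qed

lemma is_adjoint_unique:
  assumes "is_adjoint T S" "is_adjoint T S'"
  shows "S = S'"
  using is_adjointD'[OF assms(1)] is_adjointD'[OF assms(2)] by (intro blinfun_eqI cinner_ext) simp

text \<open>
  Only holomorphy in the first variable is continued: the symmetry of the kernels
  exchanges the two variables in between.
\<close>

lemma holomorphic_psd_kernel_Omega_eqI:
  fixes \<Theta> \<Psi> :: "complex ^ 'n::finite \<Rightarrow> complex ^ 'n \<Rightarrow> 'u::complex_hilbert \<Rightarrow>\<^sub>L 'u"
  assumes \<Theta>: "holomorphic_psd_kernel Omega \<Theta>" and \<Psi>: "holomorphic_psd_kernel Omega \<Psi>"
    and eq: "\<And>z \<zeta>. z \<in> half_plane_power \<Longrightarrow> \<zeta> \<in> half_plane_power \<Longrightarrow> \<Theta> z \<zeta> = \<Psi> z \<zeta>"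
    and "z \<in> Omega" "\<zeta> \<in> Omega"
  shows "\<Theta> z \<zeta> = \<Psi> z \<zeta>"
proof -
  note sub = subsetD[OF half_plane_power_subset_Omega]
  have hol: "holomorphic_op_on Omega (\<lambda>z. \<Theta> z \<zeta>)" "holomorphic_op_on Omega (\<lambda>z. \<Psi> z \<zeta>)"
    if "\<zeta> \<in> Omega" for \<zeta>
    using that \<Theta> \<Psi> by (auto simp: holomorphic_psd_kernel_def)
  have half: "\<Theta> z \<zeta> = \<Psi> z \<zeta>" if "z \<in> Omega" "\<zeta> \<in> half_plane_power" for z \<zeta>
    using that(2) sub
    by (intro holomorphic_op_on_Omega_eqI[OF hol(1) hol(2) eq that(1)]) auto
  have other: "\<Theta> z \<zeta> = \<Psi> z \<zeta>" if "z \<in> half_plane_power" "\<zeta> \<in> Omega" for z \<zeta>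
  proof (rule is_adjoint_unique)
    show "is_adjoint (\<Theta> \<zeta> z) (\<Theta> z \<zeta>)"
      using \<Theta> sub[OF that(1)] that(2) unfolding holomorphic_psd_kernel_def by blast
    show "is_adjoint (\<Theta> \<zeta> z) (\<Psi> z \<zeta>)"
      unfolding half[OF that(2,1)] using \<Psi> sub[OF that(1)] that(2) unfolding holomorphic_psd_kernel_def by blast
  qed
  show ?thesis
    by (rule holomorphic_op_on_Omega_eqI[OF hol(1) hol(2) other \<open>z \<in> Omega\<close>]) (use \<open>\<zeta> \<in> Omega\<close> in auto)
qed

section \<open>From kernels to a representation\<close>

lemma sum_nonneg_Reals:
  "(\<And>k. k \<in> I \<Longrightarrow> a k \<in> (\<real>\<^sub>\<ge>\<^sub>0 :: complex set)) \<Longrightarrow> (\<Sum>k\<in>I. a k) \<in> \<real>\<^sub>\<ge>\<^sub>0"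
  by (induction I rule: infinite_finite_induct) (auto intro: nonneg_Reals_add_I)

text \<open>
  For \<open>z\<close> in \<open>Omega\<close> one rotation \<open>l\<close> brings all \<open>z\<^sub>k\<close> into the right half-plane. Then the real part
  of \<open>l \<langle>d(z) x, x\<rangle>\<close> is at least the smallest \<open>Re (l z\<^sub>k)\<close> times the sum of the forms of the lower
  right corners, so \<open>d(z)\<close> is coercive after the rotation.
\<close>

lemma coercive_invertible_pencil:
  fixes A :: "'n::finite \<Rightarrow> ('u::complex_hilbert \<times> 'h::complex_hilbert) \<Rightarrow>\<^sub>L ('u \<times> 'h)"
  assumes psd: "\<And>k. psd_operator (A k)"
    and coercive: "\<And>x. (norm x)\<^sup>2 \<le> (\<Sum>k\<in>UNIV. Re (cinner (blinfun_apply (A k) (0, x)) (0, x)))"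
  shows "invertible_pencil A"
proof
  show "psd_operator (A k)" for k
    by (rule psd)
  fix z :: "complex ^ 'n" assume "z \<in> Omega"
  then obtain l where l: "\<And>k. Re (l * z $ k) > 0"
    unfolding mem_Omega by blast
  define c where "c = Min (range (\<lambda>k. Re (l * z $ k)))"
  have c: "c > 0" "\<And>k. c \<le> Re (l * z $ k)"
    using l by (auto simp: c_def simp del: times_complex.sel)
  have clin: "clinear_blinfun (A k)" for k
    using psd by (simp add: psd_operator_def)
  have bound: "c * (norm x)\<^sup>2 \<le> Re (l * cinner (blinfun_apply (block_d (linear_pencil A z)) x) x)" for x
  proof -
    let ?a = "\<lambda>k. cinner (blinfun_apply (A k) (0, x)) (0, x)"
    have a: "?a k \<in> \<real>\<^sub>\<ge>\<^sub>0" for k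
      using psd[of k] unfolding psd_operator_def by blast
    then have a_real: "?a k = of_real (Re (?a k))" "Re (?a k) \<ge> 0" for k
      by (auto simp: complex_nonneg_Reals_iff complex_eq_iff)
    have "cinner (blinfun_apply (block_d (linear_pencil A z)) x) x
        = cinner (blinfun_apply (linear_pencil A z) (0, x)) (0, x)"
      by (simp add: block_apply cinner_prod_def)
    also have "\<dots> = (\<Sum>k\<in>UNIV. z $ k * ?a k)"
      by (simp only: linear_pencil_apply cinner_sum_left cinner_scaleC_left)
    finally have "Re (l * cinner (blinfun_apply (block_d (linear_pencil A z)) x) x)
        = (\<Sum>k\<in>UNIV. Re (l * z $ k * ?a k))"
      by (simp add: sum_distrib_left mult.assoc del: times_complex.sel)
    also have "\<dots> = (\<Sum>k\<in>UNIV. Re (l * z $ k) * Re (?a k))"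
    proof (rule sum.cong[OF refl])
      have re: "Re (a * of_real r) = Re a * r" for a r
        by simp
      show "Re (l * z $ k * ?a k) = Re (l * z $ k) * Re (?a k)" for k
        by (subst a_real(1)) (rule re)
    qed
    also have "\<dots> \<ge> (\<Sum>k\<in>UNIV. c * Re (?a k))"
      by (intro sum_mono mult_right_mono c a_real)
    also have "(\<Sum>k\<in>UNIV. c * Re (?a k)) = c * (\<Sum>k\<in>UNIV. Re (?a k))"
      by (simp only: sum_distrib_left)
    also have "\<dots> \<ge> c * (norm x)\<^sup>2"
      by (rule mult_left_mono[OF coercive]) (use c(1) in simp)
    finally show ?thesis .
  qed
  obtain R where "is_inverse_operator (block_d (linear_pencil A z)) R"
    by (rule coercive_invertible[OF clinear_blocks(4)[OF clinear_linear_pencil[OF clin]] c(1) bound])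
  then show "\<exists>R. is_inverse_operator (block_d (linear_pencil A z)) R"
    by blast
qed

lemma span_projection_idem:
  assumes "is_span_projection B Q"
  shows "cinner (blinfun_apply Q x) y = cinner (blinfun_apply Q x) (blinfun_apply Q y)"
proof -
  have "is_adjoint Q Q" "blinfun_apply Q (blinfun_apply Q x) = blinfun_apply Q x"
    using assms span_projection_fixes[OF assms] by (simp_all add: is_span_projection_def)
  then show ?thesis
    using is_adjointD[of Q Q "blinfun_apply Q x" y] by simp
qed

lemma holomorphic_psd_kernel_nonneg:
  assumes "holomorphic_psd_kernel S \<Phi>" "\<And>\<mu>. \<mu> < m \<Longrightarrow> p \<mu> \<in> S"
  shows "(\<Sum>\<mu><m::nat. \<Sum>\<nu><m. cinner (blinfun_apply (\<Phi> (p \<mu>) (p \<nu>)) (u \<mu>)) (u \<nu>)) \<in> \<real>\<^sub>\<ge>\<^sub>0"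
  using assms unfolding holomorphic_psd_kernel_def by simp

text \<open>
  The kernels \<open>\<Phi> k\<close> become one scalar kernel in which different values of \<open>k\<close> are orthogonal. Indices
  whose point lies outside the domain must be harmless: they get the zero vector.
\<close>

lemma decomposition_scalar_kernel:
  fixes f :: "complex ^ 'n::finite \<Rightarrow> 'u::complex_hilbert \<Rightarrow>\<^sub>L 'u"
  assumes "kernel_decomposition f \<Phi>"
  shows "psd_scalar_kernel (\<lambda>(k, z, u) (l, \<zeta>, v).
    if k = l \<and> z \<in> half_plane_power \<and> \<zeta> \<in> half_plane_power
    then cinner (blinfun_apply (\<Phi> k z \<zeta>) u) v else 0)" (is "psd_scalar_kernel ?K")
proof -
  let ?P = "half_plane_power :: (complex ^ 'n) set"
  have \<Phi>: "holomorphic_psd_kernel ?P (\<Phi> k)" for k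
    using assms by (simp add: kernel_decomposition_def)
  have herm: "?K i j = cnj (?K j i)" for i j
  proof -
    obtain k z u l \<zeta> v where ij: "i = (k, z, u)" "j = (l, \<zeta>, v)"
      by (metis prod_cases3)
    have "cinner (blinfun_apply (\<Phi> k z \<zeta>) u) v = cnj (cinner (blinfun_apply (\<Phi> k \<zeta> z) v) u)"
      if "z \<in> ?P" "\<zeta> \<in> ?P"
    proof -
      have "is_adjoint (\<Phi> k z \<zeta>) (\<Phi> k \<zeta> z)"
        using \<Phi>[of k] that unfolding holomorphic_psd_kernel_def by blast
      then show ?thesis
        by (subst is_adjointD) (auto intro: cinner_commute)
    qed
    then show ?thesis
      by (auto simp: ij)
  qed
  have "(\<Sum>\<mu><m. \<Sum>\<nu><m. c \<mu> * cnj (c \<nu>) * ?K (p \<mu>) (p \<nu>)) \<in> \<real>\<^sub>\<ge>\<^sub>0" for m :: nat and p c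
  proof -
    \<comment> \<open>Positivity of \<open>\<Phi> k\<close> is applied to the whole family of points: the entries that belong to another
      \<open>k\<close>, or whose point is outside the domain, keep their place with the vector \<open>0\<close> there.\<close>
    define z where "z \<mu> = fst (snd (p \<mu>))" for \<mu>
    define z' where "z' \<mu> = (if z \<mu> \<in> ?P then z \<mu> else 1)" for \<mu>
    define w where "w k \<mu> = (if fst (p \<mu>) = k \<and> z \<mu> \<in> ?P then c \<mu> *\<^sub>C snd (snd (p \<mu>)) else 0)" for k \<mu>
    have z': "z' \<mu> \<in> ?P" for \<mu>
      by (simp add: z'_def mem_half_plane_power)
    have summand: "c \<mu> * cnj (c \<nu>) * ?K (p \<mu>) (p \<nu>)
        = (\<Sum>k\<in>UNIV. cinner (blinfun_apply (\<Phi> k (z' \<mu>) (z' \<nu>)) (w k \<mu>)) (w k \<nu>))" for \<mu> \<nu>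
    proof -
      have "?K (p \<mu>) (p \<nu>) = (if fst (p \<mu>) = fst (p \<nu>) \<and> z \<mu> \<in> ?P \<and> z \<nu> \<in> ?P
          then cinner (blinfun_apply (\<Phi> (fst (p \<mu>)) (z \<mu>) (z \<nu>)) (snd (snd (p \<mu>)))) (snd (snd (p \<nu>))) else 0)"
        by (simp add: z_def case_prod_unfold)
      moreover have "(\<Sum>k\<in>UNIV. cinner (blinfun_apply (\<Phi> k (z' \<mu>) (z' \<nu>)) (w k \<mu>)) (w k \<nu>))
          = (\<Sum>k\<in>{fst (p \<mu>)}. cinner (blinfun_apply (\<Phi> k (z' \<mu>) (z' \<nu>)) (w k \<mu>)) (w k \<nu>))"
        by (rule sum.mono_neutral_right) (auto simp: w_def)
      moreover have "clinear_blinfun (\<Phi> k (z \<mu>) (z \<nu>))" if "z \<mu> \<in> ?P" "z \<nu> \<in> ?P" for k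
        using \<Phi>[of k] that unfolding holomorphic_psd_kernel_def holomorphic_op_on_def by blast
      ultimately show ?thesis
        by (cases "z \<mu> \<in> ?P"; cases "z \<nu> \<in> ?P"; cases "fst (p \<mu>) = fst (p \<nu>)")
          (simp_all add: w_def z'_def clinear_blinfunD cinner_scaleC_left cinner_scaleC_right mult.assoc)
    qed
    have "(\<Sum>\<mu><m. \<Sum>\<nu><m. c \<mu> * cnj (c \<nu>) * ?K (p \<mu>) (p \<nu>))
        = (\<Sum>k\<in>UNIV. \<Sum>\<mu><m. \<Sum>\<nu><m. cinner (blinfun_apply (\<Phi> k (z' \<mu>) (z' \<nu>)) (w k \<mu>)) (w k \<nu>))"
      unfolding summand by (simp only: sum.swap[where B = UNIV])
    also have "\<dots> \<in> \<real>\<^sub>\<ge>\<^sub>0"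
      by (rule sum_nonneg_Reals, rule holomorphic_psd_kernel_nonneg[OF \<Phi>]) (rule z')
    finally show ?thesis .
  qed
  with herm show ?thesis
    unfolding psd_scalar_kernel_def by blast
qed

text \<open>
  Put \<open>\<eta>(z) u\<close> for the sum over \<open>k\<close> of \<open>h (k, z, u)\<close>, and let \<open>Q k\<close> be the projection onto the span of
  the \<open>h (k, z, u)\<close>. With \<open>Z = z\<^sub>1 Q\<^sub>1 + \<dots> + z\<^sub>N Q\<^sub>N\<close> the kernel identity reads
  \<open>\<langle>Z \<eta>(z) u, \<eta>(\<zeta>) v\<rangle> = \<langle>f(z) u, v\<rangle>\<close>. The right-hand side is independent of \<open>\<zeta>\<close>, so \<open>Z \<eta>(z) u\<close> is
  orthogonal to every increment \<open>g(\<zeta>) v = \<eta>(\<zeta>) v - \<eta>(1) v\<close>. Let \<open>V (u, x) = \<eta>(1) u + Q0 x\<close> with the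
  projection \<open>Q0\<close> onto the span of the increments. Then \<open>V (u, g(z) u) = \<eta>(z) u\<close>, and the pencil
  \<open>V\<^sup>* Z V\<close> sends \<open>(u, g(z) u)\<close> to \<open>(f(z) u, 0)\<close>.
  The form of \<open>V\<^sup>* Q k V\<close> at two such vectors is the given kernel \<open>\<Phi> k\<close>.

  Off the span of the increments \<open>V\<^sup>* Z V\<close> vanishes on the auxiliary space; adding the projection
  \<open>1 - Q0\<close> to each coefficient restores invertibility of the lower right corner.
\<close>

lemma realization_of_decomposition:
  fixes f :: "complex ^ 'n::finite \<Rightarrow> 'u::complex_hilbert \<Rightarrow>\<^sub>L 'u"
    and h :: "'n \<times> (complex ^ 'n) \<times> 'u \<Rightarrow> 'h::complex_hilbert"
  assumes dec: "kernel_decomposition f \<Phi>"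
    and gram: "\<And>k l z \<zeta> u v. z \<in> half_plane_power \<Longrightarrow> \<zeta> \<in> half_plane_power \<Longrightarrow>
      cinner (h (k, z, u)) (h (l, \<zeta>, v)) = (if k = l then cinner (blinfun_apply (\<Phi> k z \<zeta>) u) v else 0)"
  obtains A :: "'n \<Rightarrow> ('u \<times> 'h) \<Rightarrow>\<^sub>L ('u \<times> 'h)" and g :: "complex ^ 'n \<Rightarrow> 'u \<Rightarrow> 'h"
  where "invertible_pencil A"
    "\<And>z u. z \<in> half_plane_power \<Longrightarrow>
      blinfun_apply (linear_pencil A z) (u, g z u) = (blinfun_apply (f z) u, 0)"
    "\<And>k z \<zeta> u v. z \<in> half_plane_power \<Longrightarrow> \<zeta> \<in> half_plane_power \<Longrightarrow>
      cinner (blinfun_apply (A k) (u, g z u)) (v, g \<zeta> v) = cinner (blinfun_apply (\<Phi> k z \<zeta>) u) v"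
proof -
  let ?P = "half_plane_power :: (complex ^ 'n) set"
  have one: "1 \<in> ?P"
    by (simp add: mem_half_plane_power)
  have "holomorphic_psd_kernel ?P (\<Phi> k)" for k
    using dec by (simp add: kernel_decomposition_def)
  then have clin\<Phi>: "clinear_blinfun (\<Phi> k z \<zeta>)" if "z \<in> ?P" "\<zeta> \<in> ?P" for k z \<zeta>
    using that unfolding holomorphic_psd_kernel_def holomorphic_op_on_def by blast
  have f: "blinfun_apply (f z) u = (\<Sum>k\<in>UNIV. (z $ k) *\<^sub>C blinfun_apply (\<Phi> k z \<zeta>) u)"
    if "z \<in> ?P" "\<zeta> \<in> ?P" for z \<zeta> u
  proof -
    have "f z = (\<Sum>k\<in>UNIV. (z $ k) *\<^sub>C \<Phi> k z \<zeta>)"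
      using dec that unfolding kernel_decomposition_def kernel_identity_on_def by blast
    then show ?thesis
      by (simp add: blinfun.sum_left blinfun_apply_scaleC)
  qed

  define \<eta> where "\<eta> z u = (\<Sum>k\<in>UNIV. h (k, z, u))" for z u
  define g where "g z u = \<eta> z u - \<eta> 1 u" for z u
  define B where "B k = {h (k, z, u) | z u. z \<in> ?P}" for k
  define B0 where "B0 = {g z u | z u. z \<in> ?P}"
  have "\<exists>Q. \<forall>k. is_span_projection (B k) (Q k)"
    by (intro choice allI) (metis span_projection_exists)
  then obtain Q where Q: "\<And>k. is_span_projection (B k) (Q k)"
    by blast
  obtain Q0 where Q0: "is_span_projection B0 Q0"
    by (rule span_projection_exists)

  have Qh: "blinfun_apply (Q k) (h (l, z, u)) = (if k = l then h (l, z, u) else 0)"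
    if "z \<in> ?P" for k l z u
  proof (cases "k = l")
    case True
    then have "h (l, z, u) \<in> B k"
      using that by (auto simp: B_def)
    then show ?thesis
      using True span_projection_fixes[OF Q] subset_double_complement by auto
  next
    case False
    then have "h (l, z, u) \<in> orthocomplement (B k)"
      using that by (auto simp: B_def orthocomplement_def gram)
    then show ?thesis
      using False span_projection_kills[OF Q] by auto
  qed
  have Q\<eta>: "blinfun_apply (Q k) (\<eta> z u) = h (k, z, u)" if "z \<in> ?P" for k z u
    using that by (simp add: \<eta>_def blinfun.sum_right Qh)
  have h\<eta>: "cinner (h (k, z, u)) (\<eta> \<zeta> v) = cinner (blinfun_apply (\<Phi> k z \<zeta>) u) v"
    if "z \<in> ?P" "\<zeta> \<in> ?P" for k z \<zeta> u v
    using that by (simp add: \<eta>_def cinner_sum_right gram)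
  have Z\<eta>: "cinner (\<Sum>k\<in>UNIV. (z $ k) *\<^sub>C h (k, z, u)) (\<eta> \<zeta> v) = cinner (blinfun_apply (f z) u) v"
    if "z \<in> ?P" "\<zeta> \<in> ?P" for z \<zeta> u v
    using that by (simp add: f[OF that] cinner_sum_left cinner_scaleC_left h\<eta>)
  then have Z_perp: "(\<Sum>k\<in>UNIV. (z $ k) *\<^sub>C h (k, z, u)) \<in> orthocomplement B0" if "z \<in> ?P" for z u
    using that one by (auto simp: orthocomplement_def B0_def g_def cinner_diff_right)

  \<comment> \<open>The scalar products of the \<open>h (k, 1, u)\<close> depend sesquilinearly on the vectors \<open>u\<close>. Therefore the defect of
    linearity has norm zero.\<close>
  have "bounded_linear (\<lambda>u. h (k, 1, u))" for k
  proof (rule bounded_linear_intro)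
    note expand = cinner_diff_left cinner_diff_right cinner_add_left cinner_add_right
      cinner_scaleC_left cinner_scaleC_right gram[OF one one] blinfun.add_right
      clinear_blinfunD[OF clin\<Phi>[OF one one]] scaleR_scaleC
    show "h (k, 1, u + v) = h (k, 1, u) + h (k, 1, v)" for u v
    proof -
      let ?w = "h (k, 1, u + v) - (h (k, 1, u) + h (k, 1, v))"
      have "cinner ?w ?w = 0"
        by (simp add: expand)
      then show ?thesis
        by (simp add: cinner_self_eq_0)
    qed
    show "h (k, 1, r *\<^sub>R u) = r *\<^sub>R h (k, 1, u)" for r u
    proof -
      let ?w = "h (k, 1, r *\<^sub>R u) - r *\<^sub>R h (k, 1, u)"
      have "cinner ?w ?w = 0"
        by (simp add: expand)
      then show ?thesis
        by (simp add: cinner_self_eq_0)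
    qed
    show "norm (h (k, 1, u)) \<le> norm u * sqrt (norm (\<Phi> k 1 1))" for u
    proof (rule power2_le_imp_le)
      have "(norm (h (k, 1, u)))\<^sup>2 = inner (blinfun_apply (\<Phi> k 1 1) u) u"
        by (simp add: power2_norm_eq_inner inner_Re_cinner gram[OF one one])
      also have "\<dots> \<le> norm (blinfun_apply (\<Phi> k 1 1) u) * norm u"
        by (rule norm_cauchy_schwarz)
      also have "\<dots> \<le> (norm (\<Phi> k 1 1) * norm u) * norm u"
        by (intro mult_right_mono norm_blinfun) simp
      finally show "(norm (h (k, 1, u)))\<^sup>2 \<le> (norm u * sqrt (norm (\<Phi> k 1 1)))\<^sup>2"
        by (simp add: power_mult_distrib power2_eq_square[of "norm u"] mult_ac)
    qed simp
  qed
  then have blE: "bounded_linear (\<eta> 1)"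
    unfolding \<eta>_def by (intro bounded_linear_sum)
  define E where "E = Blinfun (\<eta> 1)"
  have E: "blinfun_apply E u = \<eta> 1 u" for u
    by (simp add: E_def bounded_linear_Blinfun_apply[OF blE])
  have "clinear_blinfun E"
  proof -
    have "h (k, 1, c *\<^sub>C u) = c *\<^sub>C h (k, 1, u)" for k c u
    proof -
      let ?w = "h (k, 1, c *\<^sub>C u) - c *\<^sub>C h (k, 1, u)"
      have "cinner ?w ?w = 0"
        by (simp add: cinner_diff_left cinner_diff_right cinner_scaleC_left cinner_scaleC_right
            gram[OF one one] clinear_blinfunD[OF clin\<Phi>[OF one one]])
      then show ?thesis
        by (simp add: cinner_self_eq_0)
    qed
    then show ?thesis
      by (simp add: clinear_blinfun_def E \<eta>_def scaleC_sum_right)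
  qed

  define V :: "('u \<times> 'h) \<Rightarrow>\<^sub>L 'h" where "V = (E o\<^sub>L fst_blinfun) + (Q0 o\<^sub>L snd_blinfun)"
  have V: "blinfun_apply V (u, x) = \<eta> 1 u + blinfun_apply Q0 x" for u x
    by (simp add: V_def blinfun.add_left E)
  have clinQ: "clinear_blinfun Q0" "\<And>k. clinear_blinfun (Q k)"
    using Q Q0 by (simp_all add: is_span_projection_def)
  have "clinear_blinfun V"
    using \<open>clinear_blinfun E\<close> clinQ(1)
    by (simp add: clinear_blinfun_def V_def blinfun.add_left scaleC_prod_def scaleC_add_right)
  then obtain S where S: "is_adjoint V S"
    by (rule adjoint_exists)
  define A where "A k = (S o\<^sub>L Q k o\<^sub>L V) + (inr_blinfun o\<^sub>L (id_blinfun - Q0) o\<^sub>L snd_blinfun)" for k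
  have A: "cinner (blinfun_apply (A k) x) y
      = cinner (blinfun_apply (Q k) (blinfun_apply V x)) (blinfun_apply V y)
        + cinner (snd x - blinfun_apply Q0 (snd x)) (snd y)" for k x y
    by (simp add: A_def blinfun.add_left blinfun.diff_left cinner_add_left is_adjointD'[OF S])
      (simp add: cinner_prod_def)
  have g_fixed: "blinfun_apply Q0 (g z u) = g z u" if "z \<in> ?P" for z u
  proof -
    have "g z u \<in> B0"
      using that by (auto simp: B0_def)
    then show ?thesis
      using span_projection_fixes[OF Q0] subset_double_complement by blast
  qed
  have Vg: "blinfun_apply V (u, g z u) = \<eta> z u" if "z \<in> ?P" for z u
    by (simp add: V g_fixed[OF that]) (simp add: g_def)

  have complement: "cinner (x - blinfun_apply Q0 x) y
      = cinner (x - blinfun_apply Q0 x) (y - blinfun_apply Q0 y)" for x y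
    using double_complement_orthogonal[of "blinfun_apply Q0 y" B0 "x - blinfun_apply Q0 x"] Q0
    by (simp add: is_span_projection_def cinner_diff_right)
  have psd: "psd_operator (A k)" for k
    unfolding psd_operator_def
  proof (intro conjI allI)
    have "clinear_blinfun S"
      by (rule adjoint_clinear[OF S])
    then show "clinear_blinfun (A k)"
      using \<open>clinear_blinfun V\<close> clinQ
      by (simp add: clinear_blinfun_def A_def blinfun.add_left blinfun.diff_left scaleC_prod_def
          scaleC_add_right scaleC_diff_right)
    have form: "cinner (blinfun_apply (A k) x) y
      = cinner (blinfun_apply (Q k) (blinfun_apply V x)) (blinfun_apply (Q k) (blinfun_apply V y))
        + cinner (snd x - blinfun_apply Q0 (snd x)) (snd y - blinfun_apply Q0 (snd y))" for x y
      by (simp only: A complement[of "snd x" "snd y"]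
          span_projection_idem[OF Q, of k "blinfun_apply V x" "blinfun_apply V y"])
    show "is_adjoint (A k) (A k)"
      unfolding is_adjoint_def
    proof (intro allI)
      fix x y
      show "cinner (blinfun_apply (A k) x) y = cinner x (blinfun_apply (A k) y)"
        unfolding cinner_commute[of x] form complex_cnj_add
        by (intro arg_cong2[where f = "(+)"] cinner_commute)
    qed
    show "cinner (blinfun_apply (A k) x) x \<in> \<real>\<^sub>\<ge>\<^sub>0" for x
      unfolding form by (intro nonneg_Reals_add_I cinner_self_nonneg)
  qed

  \<comment> \<open>The increments are sums of vectors from the mutually orthogonal ranges of the \<open>Q k\<close>. The residual
    of \<open>y\<close> is orthogonal to these vectors, hence to \<open>y\<close> and to each \<open>Q k y\<close>, hence to itself.\<close>
  have sumQ: "(\<Sum>k\<in>UNIV. blinfun_apply (Q k) y) = y" if y: "y \<in> orthocomplement (orthocomplement B0)" for y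
  proof -
    let ?w = "y - (\<Sum>k\<in>UNIV. blinfun_apply (Q k) y)"
    have adjQ: "cinner (blinfun_apply (Q k) y) x = cinner y (blinfun_apply (Q k) x)" for k x
      by (rule is_adjointD) (use Q in \<open>simp add: is_span_projection_def\<close>)
    have w_h: "cinner ?w (h (l, z, u)) = 0" if "z \<in> ?P" for l z u
      using that by (simp add: cinner_diff_left cinner_sum_left adjQ Qh if_distrib[of "cinner y"] cong: if_cong)
    then have "?w \<in> orthocomplement (B k)" for k
      by (auto simp: orthocomplement_def B_def)
    then have "cinner ?w (blinfun_apply (Q k) y) = 0" for k
      using Q double_complement_orthogonal by (metis is_span_projection_def)
    moreover have "?w \<in> orthocomplement B0"
      using w_h one by (auto simp: orthocomplement_def B0_def g_def \<eta>_def cinner_diff_right cinner_sum_right)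
    then have "cinner ?w y = 0"
      using double_complement_orthogonal[OF y] by blast
    ultimately have "cinner ?w ?w = 0"
      by (subst cinner_diff_right) (simp add: cinner_sum_right)
    then show ?thesis
      by (simp add: cinner_self_eq_0)
  qed

  have "invertible_pencil A"
  proof (rule coercive_invertible_pencil[OF psd])
    fix x
    let ?y = "blinfun_apply Q0 x"
    have y: "?y \<in> orthocomplement (orthocomplement B0)" "x - ?y \<in> orthocomplement B0"
      using Q0 by (simp_all add: is_span_projection_def)
    have "\<eta> 1 0 = 0"
      using E[of 0] by (simp add: blinfun.zero_right)
    then have A0: "cinner (blinfun_apply (A k) (0, x)) (0, x)
        = cinner (blinfun_apply (Q k) ?y) ?y + cinner (x - ?y) (x - ?y)" for k
      unfolding A by (simp add: V complement[of x x])
    have "x = ?y + (x - ?y)"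
      by simp
    then have "cinner x x = cinner ?y ?y + cinner (x - ?y) (x - ?y)"
      using double_complement_orthogonal[OF y] by (metis (no_types) cinner_add_left cinner_add_right add_0 add_0_right)
    then have "(norm x)\<^sup>2 = (norm ?y)\<^sup>2 + (norm (x - ?y))\<^sup>2"
      by (simp add: power2_norm_eq_inner inner_Re_cinner)
    also have "\<dots> \<le> (norm ?y)\<^sup>2 + real CARD('n) * (norm (x - ?y))\<^sup>2"
      by (simp add: mult_le_cancel_right1)
    also have "(norm ?y)\<^sup>2 = (\<Sum>k\<in>UNIV. Re (cinner (blinfun_apply (Q k) ?y) ?y))"
      using arg_cong[OF sumQ[OF y(1)], of "\<lambda>v. Re (cinner v ?y)"]
      by (simp add: cinner_sum_left cinner_self)
    also have "\<dots> + real CARD('n) * (norm (x - ?y))\<^sup>2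
        = (\<Sum>k\<in>UNIV. Re (cinner (blinfun_apply (A k) (0, x)) (0, x)))"
      unfolding A0 by (simp add: sum.distrib cinner_self)
    finally show "(norm x)\<^sup>2 \<le> (\<Sum>k\<in>UNIV. Re (cinner (blinfun_apply (A k) (0, x)) (0, x)))" .
  qed
  moreover have "blinfun_apply (linear_pencil A z) (u, g z u) = (blinfun_apply (f z) u, 0)"
    if z: "z \<in> ?P" for z u
  proof (rule cinner_ext)
    fix y :: "'u \<times> 'h"
    obtain v x where y: "y = (v, x)"
      by force
    have "cinner (blinfun_apply (A k) (u, g z u)) y = cinner (h (k, z, u)) (\<eta> 1 v + blinfun_apply Q0 x)" for k
      by (simp add: A Vg[OF z] Q\<eta>[OF z] g_fixed[OF z] y V[of v x])
    then have "cinner (blinfun_apply (linear_pencil A z) (u, g z u)) y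
        = cinner (\<Sum>k\<in>UNIV. (z $ k) *\<^sub>C h (k, z, u)) (\<eta> 1 v + blinfun_apply Q0 x)"
      by (simp add: linear_pencil_apply cinner_sum_left cinner_scaleC_left)
    also have "\<dots> = cinner (blinfun_apply (f z) u) v"
      using double_complement_orthogonal[OF _ Z_perp[OF z]] Q0 Z\<eta>[OF z one]
      by (simp add: cinner_add_right is_span_projection_def)
    finally show "cinner (blinfun_apply (linear_pencil A z) (u, g z u)) y = cinner (blinfun_apply (f z) u, 0) y"
      by (simp add: cinner_prod_def y)
  qed
  moreover have "cinner (blinfun_apply (A k) (u, g z u)) (v, g \<zeta> v) = cinner (blinfun_apply (\<Phi> k z \<zeta>) u) v"
    if "z \<in> ?P" "\<zeta> \<in> ?P" for k z \<zeta> u v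
    using that by (simp add: A Vg Q\<eta> h\<eta> g_fixed)
  ultimately show thesis
    by (rule that)
qed

section \<open>The two implications\<close>

lemma holomorphic_psd_kernel_subset:
  assumes "holomorphic_psd_kernel T \<Phi>" "S \<subseteq> T"
  shows "holomorphic_psd_kernel S \<Phi>"
  using assms unfolding holomorphic_psd_kernel_def holomorphic_op_on_def antiholomorphic_op_on_def
  by (meson subset_eq)

text \<open>
  The inverse in the representation is unique, so \<open>F\<close> is the transfer function of the pencil, and
  the kernels sought are those of the pencil, restricted to the product of half-planes.
\<close>

lemma decomposition_of_representation:
  fixes F :: "complex ^ 'n::finite \<Rightarrow> 'u::complex_hilbert \<Rightarrow>\<^sub>L 'u"
  assumes F: "F \<in> bessmertnyi_class_over TYPE('h::complex_hilbert)" and "homogeneous_extension f F"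
  shows "\<exists>\<Phi>. kernel_decomposition f \<Phi>"
proof -
  obtain A :: "'n \<Rightarrow> ('u \<times> 'h) \<Rightarrow>\<^sub>L ('u \<times> 'h)" where A: "long_resolvent_representation A F"
    using F unfolding bessmertnyi_class_over_def by blast
  interpret invertible_pencil A
    by standard (use A in \<open>auto simp: long_resolvent_representation_def\<close>)
  have "F z = transfer z" if z: "z \<in> Omega" for z
  proof -
    obtain R where R: "is_inverse_operator (block_d (linear_pencil A z)) R"
      "F z = block_a (linear_pencil A z) - (block_b (linear_pencil A z) o\<^sub>L R o\<^sub>L block_c (linear_pencil A z))"
      using A z unfolding long_resolvent_representation_def by blast
    show ?thesis
      unfolding R(2) transfer_def resolvent_eqI[OF z R(1)] ..
  qed
  then have "f z = transfer z" if "z \<in> half_plane_power" for z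
    using assms(2) that half_plane_power_subset_Omega unfolding homogeneous_extension_def by (metis subsetD)
  then have "kernel_decomposition f kernel"
    using kernel_identity holomorphic_psd_kernel_subset[OF holomorphic_psd_kernel_kernel half_plane_power_subset_Omega]
      half_plane_power_subset_Omega
    unfolding kernel_decomposition_def kernel_identity_on_def by (metis subsetD)
  then show ?thesis
    by blast
qed

text \<open>
  The Gram vectors of the scalar kernel are indexed by all triples \<open>(k, z, u)\<close>. The factorisation along a
  well-order places them in the \<open>\<ell>\<^sup>2\<close> space over that index set, which is the auxiliary space. The extended
  kernels are those of the representation so obtained: uniqueness of the solution column
  identifies them with \<open>\<Phi>\<close> on the product of half-planes.
\<close>

theorem representation_of_decomposition:
  fixes f :: "complex ^ 'n::finite \<Rightarrow> 'u::complex_hilbert \<Rightarrow>\<^sub>L 'u"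
  assumes dec: "kernel_decomposition f \<Phi>"
  obtains F \<Psi> where "F \<in> bessmertnyi_class" "homogeneous_extension f F"
    "\<And>k. holomorphic_psd_kernel Omega (\<Psi> k)"
    "\<And>k z \<zeta>. z \<in> half_plane_power \<Longrightarrow> \<zeta> \<in> half_plane_power \<Longrightarrow> \<Psi> k z \<zeta> = \<Phi> k z \<zeta>"
    "\<And>k l z \<zeta>. l \<noteq> 0 \<Longrightarrow> z \<in> Omega \<Longrightarrow> \<zeta> \<in> Omega \<Longrightarrow> \<Psi> k (l *s z) (l *s \<zeta>) = \<Psi> k z \<zeta>"
    "kernel_identity_on Omega F \<Psi>"
proof -
  obtain h :: "'n \<times> (complex ^ 'n) \<times> 'u \<Rightarrow> ('n \<times> (complex ^ 'n) \<times> 'u) ell2" where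
    "\<And>i j. cinner (h i) (h j) = (\<lambda>(k, z, u) (l, \<zeta>, v).
      if k = l \<and> z \<in> half_plane_power \<and> \<zeta> \<in> half_plane_power
      then cinner (blinfun_apply (\<Phi> k z \<zeta>) u) v else 0) i j"
    using Kolmogorov_decomposition[OF decomposition_scalar_kernel[OF dec] cinner_ell2_unit] by blast
  then have gram: "cinner (h (k, z, u)) (h (l, \<zeta>, v)) = (if k = l then cinner (blinfun_apply (\<Phi> k z \<zeta>) u) v else 0)"
    if "z \<in> half_plane_power" "\<zeta> \<in> half_plane_power" for k l z \<zeta> u v
    using that by simp
  obtain A :: "'n \<Rightarrow> ('u \<times> ('n \<times> (complex ^ 'n) \<times> 'u) ell2) \<Rightarrow>\<^sub>L ('u \<times> ('n \<times> (complex ^ 'n) \<times> 'u) ell2)"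
    and g where A: "invertible_pencil A"
    and pencil: "\<And>z u. z \<in> half_plane_power \<Longrightarrow>
      blinfun_apply (linear_pencil A z) (u, g z u) = (blinfun_apply (f z) u, 0)"
    and ker: "\<And>k z \<zeta> u v. z \<in> half_plane_power \<Longrightarrow> \<zeta> \<in> half_plane_power \<Longrightarrow>
      cinner (blinfun_apply (A k) (u, g z u)) (v, g \<zeta> v) = cinner (blinfun_apply (\<Phi> k z \<zeta>) u) v"
    using realization_of_decomposition[OF dec gram] by metis
  interpret invertible_pencil A by fact
  note sub = subsetD[OF half_plane_power_subset_Omega]
  have sol: "blinfun_apply (solution z) u = (u, g z u)" "blinfun_apply (transfer z) u = blinfun_apply (f z) u"
    if "z \<in> half_plane_power" for z u
    using solution_unique[OF sub[OF that] pencil[OF that]] by auto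
  show thesis
  proof (rule that[of transfer kernel])
    show "transfer \<in> bessmertnyi_class"
      unfolding bessmertnyi_class_def bessmertnyi_class_over_def
      using holomorphic_transfer long_resolvent_representation_transfer by blast
    show "homogeneous_extension f transfer"
      unfolding homogeneous_extension_def using sol(2) transfer_scale by (auto intro: blinfun_eqI)
    show "kernel k z \<zeta> = \<Phi> k z \<zeta>" if "z \<in> half_plane_power" "\<zeta> \<in> half_plane_power" for k z \<zeta>
      using that by (intro blinfun_eqI cinner_ext) (simp add: cinner_kernel sub sol ker)
  qed (use holomorphic_psd_kernel_kernel kernel_scale kernel_identity in blast)+
qed

theorem theorem2p7:
  fixes f :: "complex ^ 'n::finite \<Rightarrow> 'u \<Rightarrow>\<^sub>L 'u::complex_hilbert"
  assumes "holomorphic_op_on half_plane_power f"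
  shows
    "((\<exists>F\<in>bessmertnyi_class. homogeneous_extension f F) \<longleftrightarrow> (\<exists>\<Phi>. kernel_decomposition f \<Phi>))
     \<and> ((\<exists>F\<in>bessmertnyi_class_over TYPE('h::complex_hilbert). homogeneous_extension f F)
          \<longrightarrow> (\<exists>\<Phi>. kernel_decomposition f \<Phi>))
     \<and> (\<forall>\<Phi>. kernel_decomposition f \<Phi> \<longrightarrow>
          (\<exists>F\<in>bessmertnyi_class. homogeneous_extension f F \<and>
            (\<exists>\<Psi>.
               (\<forall>k. holomorphic_psd_kernel Omega (\<Psi> k)) \<and>
               (\<forall>k. \<forall>z\<in>half_plane_power. \<forall>\<zeta>\<in>half_plane_power. \<Psi> k z \<zeta> = \<Phi> k z \<zeta>) \<and>
               (\<forall>k l. l \<noteq> 0 \<longrightarrow> (\<forall>z\<in>Omega. \<forall>\<zeta>\<in>Omega. \<Psi> k (l *s z) (l *s \<zeta>) = \<Psi> k z \<zeta>)) \<and>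
               kernel_identity_on Omega F \<Psi> \<and>
               (\<forall>k \<Theta>. holomorphic_psd_kernel Omega \<Theta> \<and>
                  (\<forall>z\<in>half_plane_power. \<forall>\<zeta>\<in>half_plane_power. \<Theta> z \<zeta> = \<Phi> k z \<zeta>) \<longrightarrow>
                  (\<forall>z\<in>Omega. \<forall>\<zeta>\<in>Omega. \<Theta> z \<zeta> = \<Psi> k z \<zeta>)))))"
proof (intro conjI impI allI)
  show "\<exists>\<Phi>. kernel_decomposition f \<Phi>"
    if "\<exists>F\<in>bessmertnyi_class_over TYPE('h). homogeneous_extension f F"
    using that decomposition_of_representation by blast
  show "(\<exists>F\<in>bessmertnyi_class. homogeneous_extension f F) \<longleftrightarrow> (\<exists>\<Phi>. kernel_decomposition f \<Phi>)"
    using decomposition_of_representation representation_of_decomposition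
    unfolding bessmertnyi_class_def by metis
  fix \<Phi> assume dec: "kernel_decomposition f \<Phi>"
  obtain F \<Psi> where F: "F \<in> bessmertnyi_class" "homogeneous_extension f F" "kernel_identity_on Omega F \<Psi>"
    and \<Psi>: "\<And>k. holomorphic_psd_kernel Omega (\<Psi> k)"
      "\<And>k z \<zeta>. z \<in> half_plane_power \<Longrightarrow> \<zeta> \<in> half_plane_power \<Longrightarrow> \<Psi> k z \<zeta> = \<Phi> k z \<zeta>"
      "\<And>k l z \<zeta>. l \<noteq> 0 \<Longrightarrow> z \<in> Omega \<Longrightarrow> \<zeta> \<in> Omega \<Longrightarrow> \<Psi> k (l *s z) (l *s \<zeta>) = \<Psi> k z \<zeta>"
    using representation_of_decomposition[OF dec] by metis
  have unique: "\<Theta> z \<zeta> = \<Psi> k z \<zeta>"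
    if "holomorphic_psd_kernel Omega \<Theta>" "z \<in> Omega" "\<zeta> \<in> Omega"
      "\<forall>z\<in>half_plane_power. \<forall>\<zeta>\<in>half_plane_power. \<Theta> z \<zeta> = \<Phi> k z \<zeta>" for k \<Theta> z \<zeta>
    by (rule holomorphic_psd_kernel_Omega_eqI[OF that(1) \<Psi>(1) _ that(2,3)]) (use that(4) \<Psi>(2) in simp)
  show "\<exists>F\<in>bessmertnyi_class. homogeneous_extension f F \<and>
      (\<exists>\<Psi>.
         (\<forall>k. holomorphic_psd_kernel Omega (\<Psi> k)) \<and>
         (\<forall>k. \<forall>z\<in>half_plane_power. \<forall>\<zeta>\<in>half_plane_power. \<Psi> k z \<zeta> = \<Phi> k z \<zeta>) \<and>
         (\<forall>k l. l \<noteq> 0 \<longrightarrow> (\<forall>z\<in>Omega. \<forall>\<zeta>\<in>Omega. \<Psi> k (l *s z) (l *s \<zeta>) = \<Psi> k z \<zeta>)) \<and>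
         kernel_identity_on Omega F \<Psi> \<and>
         (\<forall>k \<Theta>. holomorphic_psd_kernel Omega \<Theta> \<and>
            (\<forall>z\<in>half_plane_power. \<forall>\<zeta>\<in>half_plane_power. \<Theta> z \<zeta> = \<Phi> k z \<zeta>) \<longrightarrow>
            (\<forall>z\<in>Omega. \<forall>\<zeta>\<in>Omega. \<Theta> z \<zeta> = \<Psi> k z \<zeta>)))"
    by (intro bexI[of _ F] conjI exI[of _ \<Psi>] allI impI ballI) (simp_all add: F \<Psi> unique)
qed

end
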